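(* Let $G$ be a (nonempty, connected) positive signed graph. Then $G$ is $t$-equivalent to one of the simply laced Dynkin diagrams $A_n$ ($n\ge1$), $D_n$ ($n\geq 4$), $E_6$, $E_7$, $E_8$.
   Context: A *signed graph* is a finite simple graph in which every edge is assigned a sign $+1$ or $-1$. Its adjacency matrix $A(G)$ is the symmetric integer matrix, indexed by the vertices, whose $(v,w)$ entry is the sign of the edge joining $v$ and $w$ if there is one and $0$ otherwise (zero diagonal). $G$ is *positive* if $2I+A(G)$ is positive definite. Graphs are considered up to isomorphism. An (induced) cycle in a signed graph is *positive* if its number of vertices and its number of negative edges have different parity. In a positive signed graph all induced cycles are positive. *$t$-move.* Let $G$ be a signed graph all of whose (induced) cycles are positive. Pick an edge $(x,y)$ of $G$ with sign $\epsilon\in\{1,-1\}$ and choose one of its endpoints, $x$. For every vertex $v\neq x$ adjacent to $y$: if $x$ and $v$ are adjacent, remove the edge $(x,v)$; if not, add an edge $(x,v)$ whose sign is that of $(y,v)$ if $\epsilon=-1$ and the opposite of that of $(y,v)$ if $\epsilon=1$. Finally change the sign of the edge $(x,y)$ from $\epsilon$ to $-\epsilon$. Two signed graphs $G_1,G_2$ are *$t$-equivalent*, written $G_1\sim G_2$, if there is a (finite) sequence of $t$-moves changing $G_1$ into $G_2$. *Dynkin diagrams.* $A_n$ is the path on $n$ vertices; $D_n$ ($n\geq 4$) is a path on $n-1$ vertices with one more vertex attached to the second vertex of the path; $E_n$ ($n=6,7,8$) is a path on $n-1$ vertices with one more vertex attached to the third vertex of the path. Since these are trees, signs are ignored: a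 signed graph is regarded as one of these diagrams if its underlying unsigned graph is. *)

theory Defs
  imports Complex_Main
begin

record 'a ugraph =
  verts :: "'a set"
  edges :: "'a set set"

definition simple_graph :: "('a, 'm) ugraph_scheme \<Rightarrow> bool" where
  "simple_graph G \<longleftrightarrow> finite (verts G) \<and> (\<forall>e\<in>edges G. e \<subseteq> verts G \<and> card e = 2)"

abbreviation adjacent :: "('a, 'm) ugraph_scheme \<Rightarrow> 'a \<Rightarrow> 'a \<Rightarrow> bool" where
  "adjacent G v w \<equiv> {v, w} \<in> edges G"

definition connected_graph :: "('a, 'm) ugraph_scheme \<Rightarrow> bool" where
  "connected_graph G \<longleftrightarrow> (\<forall>v\<in>verts G. \<forall>w\<in>verts G. (adjacent G)\<^sup>*\<^sup>* v w)"

definition graph_isomorphism ::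
    "('a \<Rightarrow> 'b) \<Rightarrow> ('a, 'm) ugraph_scheme \<Rightarrow> ('b, 'n) ugraph_scheme \<Rightarrow> bool" where
  "graph_isomorphism f G H \<longleftrightarrow>
     bij_betw f (verts G) (verts H) \<and>
     (\<forall>v\<in>verts G. \<forall>w\<in>verts G. adjacent G v w \<longleftrightarrow> adjacent H (f v) (f w))"

text \<open>As every function on graph schemes ignores the signs, comparing a signed graph with an
  unsigned one below means comparing its underlying unsigned graph.\<close>

definition graph_iso :: "('a, 'm) ugraph_scheme \<Rightarrow> ('b, 'n) ugraph_scheme \<Rightarrow> bool" where
  "graph_iso G H \<longleftrightarrow> (\<exists>f. graph_isomorphism f G H)"

text \<open>The values of \<open>esign\<close> outside the set of edges carry no meaning.\<close>

record 'a sgraph = "'a ugraph" +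
  esign :: "'a set \<Rightarrow> int"

definition signed_graph :: "'a sgraph \<Rightarrow> bool" where
  "signed_graph G \<longleftrightarrow> simple_graph G \<and> (\<forall>e\<in>edges G. esign G e \<in> {1, -1})"

definition signed_iso :: "'a sgraph \<Rightarrow> 'b sgraph \<Rightarrow> bool" where
  "signed_iso G H \<longleftrightarrow>
     (\<exists>f. graph_isomorphism f G H \<and> (\<forall>e\<in>edges G. esign H (f ` e) = esign G e))"

definition adj_matrix :: "'a sgraph \<Rightarrow> 'a \<Rightarrow> 'a \<Rightarrow> int" where
  "adj_matrix G v w = (if adjacent G v w then esign G {v, w} else 0)"

definition positive_definite_on :: "'a set \<Rightarrow> ('a \<Rightarrow> 'a \<Rightarrow> real) \<Rightarrow> bool" where
  "positive_definite_on V M \<longleftrightarrow>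
     (\<forall>x. (\<exists>v\<in>V. x v \<noteq> 0) \<longrightarrow> 0 < (\<Sum>v\<in>V. \<Sum>w\<in>V. x v * M v w * x w))"

definition positive_graph :: "'a sgraph \<Rightarrow> bool" where
  "positive_graph G \<longleftrightarrow>
     positive_definite_on (verts G)
       (\<lambda>v w. 2 * (if v = w then 1 else 0) + real_of_int (adj_matrix G v w))"

text \<open>An induced cycle is given by the list of its vertices in cyclic order.\<close>

definition induced_cycle :: "('a, 'm) ugraph_scheme \<Rightarrow> 'a list \<Rightarrow> bool" where
  "induced_cycle G c \<longleftrightarrow>
     3 \<le> length c \<and> distinct c \<and> set c \<subseteq> verts G \<and>
     (\<forall>i<length c. \<forall>j<length c.
        adjacent G (c ! i) (c ! j) \<longleftrightarrow>
          j = Suc i mod length c \<or> i = Suc j mod length c)"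

definition positive_cycle :: "'a sgraph \<Rightarrow> 'a list \<Rightarrow> bool" where
  "positive_cycle G c \<longleftrightarrow>
     even (length c) \<noteq> even (card {e \<in> edges G. e \<subseteq> set c \<and> esign G e = -1})"

definition cycles_positive :: "'a sgraph \<Rightarrow> bool" where
  "cycles_positive G \<longleftrightarrow> (\<forall>c. induced_cycle G c \<longrightarrow> positive_cycle G c)"

text \<open>The result of the \<open>t\<close>-move at the edge \<open>{x, y}\<close> with chosen endpoint \<open>x\<close>.  The set \<open>S\<close>
  consists of the pairs \<open>{x, v}\<close> with \<open>v \<noteq> x\<close> adjacent to \<open>y\<close>; those that are edges are removed
  and the others become edges.  For \<open>e = {x, v}\<close> in \<open>S\<close>, the set \<open>insert y (e - {x})\<close> is the
  edge \<open>{y, v}\<close>.  Note that \<open>{x, y}\<close> is not in \<open>S\<close>, as \<open>y\<close> is not adjacent to itself.\<close>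

definition t_transform :: "'a sgraph \<Rightarrow> 'a \<Rightarrow> 'a \<Rightarrow> 'a sgraph" where
  "t_transform G x y =
     (let \<epsilon> = esign G {x, y};
          S = {{x, v} | v. v \<noteq> x \<and> adjacent G y v}
      in \<lparr>verts = verts G,
          edges = (edges G - S) \<union> (S - edges G),
          esign = (\<lambda>e. if e = {x, y} then - \<epsilon>
                       else if e \<in> S then
                         (if \<epsilon> = -1 then esign G (insert y (e - {x}))
                          else - esign G (insert y (e - {x})))
                       else esign G e)\<rparr>)"

definition t_move :: "'a sgraph \<Rightarrow> 'a sgraph \<Rightarrow> bool" where
  "t_move G H \<longleftrightarrow>
     cycles_positive G \<and> (\<exists>x y. adjacent G x y \<and> H = t_transform G x y)"

text \<open>Signed graphs are considered up to isomorphism.  Since \<open>t\<close>-moves commute with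
  isomorphisms, it is enough to allow one isomorphism at the end of the sequence.\<close>

definition t_equivalent :: "'a sgraph \<Rightarrow> 'b sgraph \<Rightarrow> bool" where
  "t_equivalent G H \<longleftrightarrow> (\<exists>K. t_move\<^sup>*\<^sup>* G K \<and> signed_iso K H)"

definition path_edges :: "nat \<Rightarrow> nat set set" where
  "path_edges m = {{i, Suc i} | i. 1 \<le> i \<and> i < m}"

definition dynkin_A :: "nat \<Rightarrow> nat ugraph" where
  "dynkin_A n = \<lparr>verts = {1..n}, edges = path_edges n\<rparr>"

definition dynkin_D :: "nat \<Rightarrow> nat ugraph" where
  "dynkin_D n = \<lparr>verts = {1..n}, edges = insert {2, n} (path_edges (n - 1))\<rparr>"

definition dynkin_E :: "nat \<Rightarrow> nat ugraph" where
  "dynkin_E n = \<lparr>verts = {1..n}, edges = insert {3, n} (path_edges (n - 1))\<rparr>"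

definition simply_laced_dynkin :: "('a, 'm) ugraph_scheme \<Rightarrow> bool" where
  "simply_laced_dynkin H \<longleftrightarrow>
     (\<exists>n\<ge>1. graph_iso H (dynkin_A n)) \<or>
     (\<exists>n\<ge>4. graph_iso H (dynkin_D n)) \<or>
     (\<exists>n\<in>{6, 7, 8}. graph_iso H (dynkin_E n))"

end

theory Submission
  imports Defs
begin

text \<open>The matrix \<open>2I + A(G)\<close> of a positive signed graph is the Gram matrix of a basis of vectors
  \<open>\<alpha>\<^sub>v\<close> of squared length \<open>2\<close> in a Euclidean space.  In this picture the \<open>t\<close>-move at the edge
  \<open>{x, y}\<close> replaces \<open>\<alpha>\<^sub>x\<close> by its image under the reflection that sends \<open>\<alpha>\<^sub>y\<close> to its negative
  (\<open>gram_t_transform_moved\<close>).  Hence positivity is preserved, and with it the condition on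
  cycles under which a \<open>t\<close>-move is defined, since a cycle of the wrong parity carries an
  isotropic vector (\<open>positive_graph_cycles_positive\<close>).

  The argument has two halves.  First, up to replacing some \<open>\<alpha>\<^sub>v\<close> by their negatives, one can reach
  a basis in which all inner products of distinct vectors are at most \<open>0\<close>.  The vectors are
  treated one at a time.  If the vectors with index in \<open>W\<close> are already in this position, they
  are the simple roots of a finite root system; moving another vector \<open>\<alpha>\<^sub>v\<close> by reflections in
  them is acting by the Weyl group, and every orbit meets the antidominant chamber
  (\<open>antidominant_vertex\<close>).  The proof does not mention root systems: it is a direct
  termination argument for repeatedly subtracting a simple root with which \<open>\<alpha>\<^sub>v\<close> has inner
  product \<open>1\<close>.

  Second, a connected graph with \<open>2I - A\<close> positive definite is a Dynkin diagram
  (\<open>dynkin_on_connected\<close>).  This is the classical classification by excluding the extended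
  diagrams, each of which carries a vector with nonpositive form.  It is organised as a growth
  process: a single vertex is of type \<open>A\<^sub>1\<close>; a vertex adjacent to an induced Dynkin subgraph is
  adjacent to exactly one of its vertices; and attaching a vertex to \<open>A\<^sub>n\<close>, \<open>D\<^sub>n\<close> or \<open>E\<^sub>n\<close> gives
  either another diagram in the list or one that contains an extended diagram.\<close>

section \<open>The Gram matrix of a signed graph\<close>

text \<open>The matrix \<open>2I + A(G)\<close>.  When it is positive definite, it is the Gram matrix of linearly
  independent vectors \<open>\<alpha>\<^sub>v\<close> of squared length \<open>2\<close>; the comments below speak of these vectors.\<close>
definition gram :: "'a sgraph \<Rightarrow> 'a \<Rightarrow> 'a \<Rightarrow> int" where
  "gram G v w = 2 * (if v = w then 1 else 0) + adj_matrix G v w"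

lemma positive_graph_gram:
  "positive_graph G \<longleftrightarrow> positive_definite_on (verts G) (\<lambda>v w. real_of_int (gram G v w))"
  by (simp add: positive_graph_def gram_def if_distrib[of real_of_int] cong: if_cong)

lemma positive_definite_on_subset:
  assumes "positive_definite_on V M" "finite V" "S \<subseteq> V"
  shows "positive_definite_on S M"
  unfolding positive_definite_on_def
proof (intro allI impI)
  fix x :: "'a \<Rightarrow> real"
  assume nz: "\<exists>v\<in>S. x v \<noteq> 0"
  define z where "z v = (if v \<in> S then x v else 0)" for v
  have "\<exists>v\<in>V. z v \<noteq> 0"
    using nz \<open>S \<subseteq> V\<close> by (auto simp: z_def)
  then have "0 < (\<Sum>v\<in>V. \<Sum>w\<in>V. z v * M v w * z w)"
    using assms(1) by (auto simp: positive_definite_on_def)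
  also have "\<dots> = (\<Sum>v\<in>S. \<Sum>w\<in>V. z v * M v w * z w)"
    by (rule sum.mono_neutral_right) (use assms in \<open>auto simp: z_def\<close>)
  also have "\<dots> = (\<Sum>v\<in>S. \<Sum>w\<in>S. x v * M v w * x w)"
  proof (rule sum.cong[OF refl])
    fix v assume "v \<in> S"
    have "(\<Sum>w\<in>V. z v * M v w * z w) = (\<Sum>w\<in>S. z v * M v w * z w)"
      by (rule sum.mono_neutral_right) (use assms in \<open>auto simp: z_def\<close>)
    then show "(\<Sum>w\<in>V. z v * M v w * z w) = (\<Sum>w\<in>S. x v * M v w * x w)"
      using \<open>v \<in> S\<close> by (simp add: z_def)
  qed
  finally show "0 < (\<Sum>v\<in>S. \<Sum>w\<in>S. x v * M v w * x w)" .
qed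

lemma adj_matrix_commute: "adj_matrix G v w = adj_matrix G w v"
  by (simp add: adj_matrix_def insert_commute)

lemma gram_commute: "gram G v w = gram G w v"
  by (simp add: gram_def adj_matrix_commute)

lemma signed_graph_adjacentD:
  assumes "signed_graph G" "adjacent G v w"
  shows "v \<noteq> w" "v \<in> verts G" "w \<in> verts G" "esign G {v, w} = 1 \<or> esign G {v, w} = -1"
proof -
  have "{v, w} \<subseteq> verts G" "card {v, w} = 2" "esign G {v, w} \<in> {1, -1}"
    using assms by (auto simp: signed_graph_def simple_graph_def)
  then show "v \<noteq> w" "v \<in> verts G" "w \<in> verts G" "esign G {v, w} = 1 \<or> esign G {v, w} = -1"
    by (auto split: if_splits)
qed

lemma gram_self: "signed_graph G \<Longrightarrow> gram G v v = 2"
  using signed_graph_adjacentD(1)[of G v v] by (auto simp: gram_def adj_matrix_def)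

lemma gram_range:
  "signed_graph G \<Longrightarrow> v \<noteq> w \<Longrightarrow> gram G v w \<in> {-1, 0, 1}"
  using signed_graph_adjacentD(4)[of G v w] by (auto simp: gram_def adj_matrix_def)

lemma adjacent_iff_gram:
  "signed_graph G \<Longrightarrow> v \<noteq> w \<Longrightarrow> adjacent G v w \<longleftrightarrow> gram G v w \<noteq> 0"
  using signed_graph_adjacentD(4)[of G v w] by (auto simp: gram_def adj_matrix_def)

text \<open>If the signs violated the equation, the vector \<open>\<alpha>\<^sub>x - \<epsilon> \<alpha>\<^sub>y + \<epsilon> \<delta> \<alpha>\<^sub>w\<close>, where \<open>\<epsilon>\<close> and \<open>\<delta>\<close> are
  the signs of \<open>{x, y}\<close> and \<open>{y, w}\<close>, would be isotropic.  The equation says that the edge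
  \<open>{x, w}\<close> removed by the \<open>t\<close>-move is one for which the reflected vector is orthogonal to
  \<open>\<alpha>\<^sub>w\<close>.\<close>
lemma triangle_sign:
  assumes "signed_graph G" "positive_graph G"
    and "adjacent G x y" "adjacent G x w" "adjacent G y w"
  shows "gram G x w = gram G x y * gram G y w"
proof (rule ccontr)
  assume neq: "gram G x w \<noteq> gram G x y * gram G y w"
  note adj = signed_graph_adjacentD[OF assms(1)]
  have d: "x \<noteq> y" "x \<noteq> w" "y \<noteq> w" and V: "{x, y, w} \<subseteq> verts G"
    using adj assms(3-5) by blast+
  have r: "gram G x y \<in> {1, -1}" "gram G x w \<in> {1, -1}" "gram G y w \<in> {1, -1}"
    using gram_range[OF assms(1)] adjacent_iff_gram[OF assms(1)] d assms(3-5) by fastforce+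
  define \<epsilon> \<delta> where "\<epsilon> = real_of_int (gram G x y)" and "\<delta> = real_of_int (gram G y w)"
  have e: "\<epsilon> = 1 \<or> \<epsilon> = -1" "\<delta> = 1 \<or> \<delta> = -1" "real_of_int (gram G x w) = - \<epsilon> * \<delta>"
    using r neq by (auto simp: \<epsilon>_def \<delta>_def)
  have "positive_definite_on {x, y, w} (\<lambda>v w. real_of_int (gram G v w))"
    using assms(1,2) V
    by (auto simp: positive_graph_gram signed_graph_def simple_graph_def
             intro: positive_definite_on_subset)
  then have "\<And>z. (\<exists>v\<in>{x, y, w}. z v \<noteq> 0) \<Longrightarrow>
      0 < (\<Sum>u\<in>{x, y, w}. \<Sum>v\<in>{x, y, w}. z u * real_of_int (gram G u v) * z v)"
    by (auto simp: positive_definite_on_def)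
  from this[of "\<lambda>u. if u = x then 1 else if u = y then - \<epsilon> else \<epsilon> * \<delta>"]
  show False
    using d e gram_self[OF assms(1)]
      gram_commute[of G y x] gram_commute[of G w x] gram_commute[of G w y]
    by (auto simp flip: \<epsilon>_def \<delta>_def)
qed

section \<open>Induced cycles of positive graphs\<close>

lemma prod_uminus_signs:
  fixes e :: "nat \<Rightarrow> int"
  assumes "\<And>i. i < n \<Longrightarrow> e i \<in> {1, -1}"
  shows "(\<Prod>i<n. - e i) = (-1) ^ (n + card {i. i < n \<and> e i = -1})"
  using assms
proof (induction n)
  case (Suc n)
  have "{i. i < Suc n \<and> e i = -1} =
      (if e n = -1 then insert n {i. i < n \<and> e i = -1} else {i. i < n \<and> e i = -1})"
    by (auto simp: less_Suc_eq)
  with Suc show ?case by auto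
qed simp

text \<open>On a cycle with edge signs \<open>e\<^sub>i\<close>, the coefficients \<open>x\<^sub>i\<^sub>+\<^sub>1 = - e\<^sub>i x\<^sub>i\<close> with \<open>x\<^sub>0 = 1\<close> close up
  consistently exactly if the product of all \<open>- e\<^sub>i\<close> is \<open>1\<close>, that is, if the length and the number
  of negative edges have the same parity.  In that case every edge cancels half of the
  contribution of each of its endpoints, and the form vanishes at \<open>x\<close>.\<close>
lemma positive_graph_cycles_positive:
  assumes "signed_graph G" "positive_graph G"
  shows "cycles_positive G"
  unfolding cycles_positive_def
proof (intro allI impI)
  fix c assume cyc: "induced_cycle G c"
  define n where "n = length c"
  define s where "s i = Suc i mod n" for i
  define e where "e i = esign G {c ! i, c ! s i}" for i
  have n: "3 \<le> n" and dist: "distinct c" and cV: "set c \<subseteq> verts G"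
    and adj: "\<And>i j. i < n \<Longrightarrow> j < n \<Longrightarrow> adjacent G (c ! i) (c ! j) \<longleftrightarrow> j = s i \<or> i = s j"
    using cyc by (auto simp: induced_cycle_def n_def s_def)
  have s_less: "s i < n" for i
    using n by (simp add: s_def)
  have s_s: "s (s i) \<noteq> i" and s_inj: "s i = s j \<Longrightarrow> i = j" if "i < n" "j < n" for i j
  proof -
    have s': "s i = (if Suc i = n then 0 else Suc i)" if "i < n" for i
      using that by (auto simp: s_def)
    show "s (s i) \<noteq> i" using s'[of i] s'[of "s i"] s_less[of i] that n by (auto split: if_splits)
    show "i = j" if "s i = s j" using s'[of i] s'[of j] that \<open>i < n\<close> \<open>j < n\<close> by (auto split: if_splits)
  qed
  have e: "e i \<in> {1, -1}" if "i < n" for i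
    using adj[of i "s i"] s_less that signed_graph_adjacentD(4)[OF assms(1)] by (auto simp: e_def)
  have nth_inj: "c ! i = c ! j \<longleftrightarrow> i = j" if "i < n" "j < n" for i j
    using that dist by (simp add: nth_eq_iff_index_eq n_def)
  \<comment> \<open>Going once around the cycle numbers its edges.\<close>
  have "bij_betw (\<lambda>i. {c ! i, c ! s i}) {i. i < n \<and> e i = -1}
      {f \<in> edges G. f \<subseteq> set c \<and> esign G f = -1}"
    unfolding bij_betw_def
  proof (intro conjI inj_onI equalityI subsetI)
    fix i j assume "i \<in> {i. i < n \<and> e i = -1}" "j \<in> {i. i < n \<and> e i = -1}"
      "{c ! i, c ! s i} = {c ! j, c ! s j}"
    then show "i = j"
      using s_less s_s nth_inj by (auto simp: doubleton_eq_iff)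
  next
    fix f assume "f \<in> (\<lambda>i. {c ! i, c ! s i}) ` {i. i < n \<and> e i = -1}"
    then show "f \<in> {f \<in> edges G. f \<subseteq> set c \<and> esign G f = -1}"
      using adj s_less by (auto simp: e_def n_def)
  next
    fix f assume f: "f \<in> {f \<in> edges G. f \<subseteq> set c \<and> esign G f = -1}"
    then obtain u w where "f = {u, w}"
      using assms(1) by (auto simp: signed_graph_def simple_graph_def card_2_iff)
    then obtain i j where ij: "i < n" "j < n" "f = {c ! i, c ! j}"
      using f by (auto simp: in_set_conv_nth n_def)
    then have "j = s i \<or> i = s j"
      using f adj by auto
    then show "f \<in> (\<lambda>i. {c ! i, c ! s i}) ` {i. i < n \<and> e i = -1}"
    proof
      assume "j = s i" then show ?thesis using ij f by (auto simp: e_def)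
    next
      assume "i = s j" then show ?thesis using ij f by (auto simp: e_def insert_commute intro!: image_eqI[of _ _ j])
    qed
  qed
  then have card: "card {f \<in> edges G. f \<subseteq> set c \<and> esign G f = -1} = card {i. i < n \<and> e i = -1}"
    by (simp add: bij_betw_same_card)
  show "positive_cycle G c"
  proof (rule ccontr)
    assume "\<not> positive_cycle G c"
    then have "even (n + card {i. i < n \<and> e i = -1})"
      by (auto simp: positive_cycle_def card n_def)
    then have prod: "(\<Prod>i<n. - e i) = 1"
      using prod_uminus_signs[OF e] by simp
    define x where "x i = (\<Prod>j<i. - e j)" for i
    have x_s: "x (s i) = - e i * x i" if "i < n" for i
    proof (cases "Suc i = n")
      case True
      then show ?thesis using prod by (auto simp: s_def x_def mult.commute)
    next
      case False
      then show ?thesis using that by (auto simp: s_def x_def)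
    qed
    have x_sq: "x i * x i = 1" if "i \<le> n" for i
      using that
    proof (induction i)
      case (Suc i)
      then have "x (Suc i) * x (Suc i) = (e i * e i) * (x i * x i)"
        by (simp add: x_def)
      then show ?case using Suc e[of i] by auto
    qed (simp add: x_def)
    have edge: "x i * e i * x (s i) = -1" if "i < n" for i
    proof -
      have "x i * e i * x (s i) = - (e i * e i) * (x i * x i)"
        using x_s[OF that] by simp
      then show ?thesis using that x_sq[of i] e[of i] by auto
    qed
    have gram_c: "gram G (c ! i) (c ! j) =
        (if i = j then 2 else 0) + (if j = s i then e i else 0) + (if i = s j then e j else 0)"
      if "i < n" "j < n" for i j
    proof -
      have "\<not> (j = s i \<and> i = s j)" using s_s that by metis
      moreover have "i \<noteq> s i" using adj[of i i] signed_graph_adjacentD(1)[OF assms(1)] that by blast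
      ultimately show ?thesis
        using that adj[of i j] nth_inj[of i j]
        by (auto simp: gram_def adj_matrix_def e_def insert_commute)
    qed
    have "inj_on ((!) c) {..<n}"
      using nth_inj by (auto intro: inj_onI)
    have set_c: "set c = (!) c ` {..<n}"
      by (auto simp: n_def in_set_conv_nth)
    define X where "X v = real_of_int (x (the_inv_into {..<n} ((!) c) v))" for v
    have X: "X (c ! i) = x i" if "i < n" for i
      using that by (simp add: X_def the_inv_into_f_f \<open>inj_on ((!) c) {..<n}\<close>)
    have "positive_definite_on (set c) (\<lambda>v w. real_of_int (gram G v w))"
      using assms cV
      by (auto simp: positive_graph_gram signed_graph_def simple_graph_def
               intro: positive_definite_on_subset)
    moreover have "\<exists>v\<in>set c. X v \<noteq> 0"
    proof
      show "c ! 0 \<in> set c" using n by (auto simp: n_def intro!: nth_mem)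
      show "X (c ! 0) \<noteq> 0" using X[of 0] n by (simp add: x_def)
    qed
    ultimately have "0 < (\<Sum>v\<in>set c. \<Sum>w\<in>set c. X v * real_of_int (gram G v w) * X w)"
      by (auto simp: positive_definite_on_def)
    also have "\<dots> = (\<Sum>i<n. \<Sum>j<n. X (c ! i) * real_of_int (gram G (c ! i) (c ! j)) * X (c ! j))"
      unfolding set_c by (simp add: sum.reindex \<open>inj_on ((!) c) {..<n}\<close>)
    also have "\<dots> = real_of_int (\<Sum>i<n. \<Sum>j<n. x i * gram G (c ! i) (c ! j) * x j)"
      by (simp add: X)
    also have "(\<Sum>i<n. \<Sum>j<n. x i * gram G (c ! i) (c ! j) * x j) =
        (\<Sum>i<n. \<Sum>j<n. (if i = j then 2 * (x i * x i) else 0) +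
          (if j = s i then x i * e i * x (s i) else 0) + (if i = s j then x j * e j * x (s j) else 0))"
      by (intro sum.cong refl) (auto simp: gram_c algebra_simps)
    also have "\<dots> = (\<Sum>i<n. 2 * (x i * x i)) + (\<Sum>i<n. x i * e i * x (s i)) + (\<Sum>j<n. x j * e j * x (s j))"
      using s_less
      by (simp add: sum.distrib sum.swap[of "\<lambda>i j. if i = s j then x j * e j * x (s j) else 0"])
    also have "\<dots> = 0"
      using x_sq edge by simp
    finally show False by simp
  qed
qed

section \<open>The \<open>t\<close>-move as a reflection\<close>

lemma verts_t_transform [simp]: "verts (t_transform G x y) = verts G"
  by (simp add: t_transform_def Let_def)

lemma gram_t_transform_other:
  assumes "u \<noteq> x" "w \<noteq> x"
  shows "gram (t_transform G x y) u w = gram G u w"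
proof -
  define S where "S = {{x, v} | v. v \<noteq> x \<and> adjacent G y v}"
  have "{u, w} \<notin> S" "{u, w} \<noteq> {x, y}"
    using assms by (auto simp: S_def doubleton_eq_iff)
  then show ?thesis
    by (simp add: gram_def adj_matrix_def t_transform_def Let_def flip: S_def)
qed

text \<open>This is where the combinatorial recipe of the \<open>t\<close>-move is recognised as replacing \<open>\<alpha>\<^sub>x\<close> by its
  reflection \<open>\<alpha>\<^sub>x - (\<alpha>\<^sub>x, \<alpha>\<^sub>y) \<alpha>\<^sub>y\<close> in the hyperplane orthogonal to \<open>\<alpha>\<^sub>y\<close>.  A removed edge
  completes a triangle, and there positivity forces the new inner product to be \<open>0\<close>.\<close>
lemma gram_t_transform_moved:
  assumes "signed_graph G" "positive_graph G" "adjacent G x y" "w \<noteq> x"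
  shows "gram (t_transform G x y) x w = gram G x w - gram G x y * gram G y w"
proof -
  define S where "S = {{x, v} | v. v \<noteq> x \<and> adjacent G y v}"
  define H where "H = t_transform G x y"
  note adj = signed_graph_adjacentD[OF assms(1)]
  have xy: "x \<noteq> y" using adj assms(3) by blast
  have S: "{x, w} \<in> S \<longleftrightarrow> adjacent G y w"
    using \<open>w \<noteq> x\<close> by (auto simp: S_def doubleton_eq_iff)
  have edges_H: "{x, w} \<in> edges H \<longleftrightarrow> adjacent G x w \<noteq> adjacent G y w"
    using S by (auto simp: H_def t_transform_def Let_def S_def[symmetric])
  have "insert y ({x, w} - {x}) = {y, w}"
    using \<open>w \<noteq> x\<close> by auto
  then have sign_H: "esign H {x, w} =
      (if w = y then - esign G {x, y} else if adjacent G y w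
       then (if esign G {x, y} = -1 then esign G {y, w} else - esign G {y, w}) else esign G {x, w})"
    using S \<open>w \<noteq> x\<close> by (auto simp: H_def t_transform_def Let_def S_def[symmetric] doubleton_eq_iff)
  have gxy: "gram G x y = esign G {x, y}"
    using assms(3) xy by (simp add: gram_def adj_matrix_def)
  have nyy: "\<not> adjacent G y y" using adj(1) by blast
  show ?thesis
  proof (cases "w = y")
    case True
    then show ?thesis
      using edges_H sign_H assms(3) xy nyy gxy gram_self[OF assms(1), of y]
      by (auto simp: gram_def adj_matrix_def H_def[symmetric])
  next
    case False
    show ?thesis
    proof (cases "adjacent G x w \<and> adjacent G y w")
      case True
      then have "gram G x w = gram G x y * gram G y w"
        using triangle_sign[OF assms(1-3)] by simp
      moreover have "gram H x w = 0"
        using edges_H True \<open>w \<noteq> x\<close> by (simp add: gram_def adj_matrix_def)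
      ultimately show ?thesis by (simp add: H_def)
    next
      case n: False
      have \<epsilon>: "gram G x y = 1 \<or> gram G x y = -1"
        using gxy adj(4)[OF assms(3)] by simp
      have 1: "gram H x w = (if adjacent H x w then esign H {x, w} else 0)"
          "gram G x w = (if adjacent G x w then esign G {x, w} else 0)"
          "gram G y w = (if adjacent G y w then esign G {y, w} else 0)"
        using \<open>w \<noteq> x\<close> False by (simp_all add: gram_def adj_matrix_def)
      show ?thesis
        unfolding H_def[symmetric] 1 edges_H sign_H gxy[symmetric]
        using n False \<epsilon> by (cases "adjacent G y w"; cases "adjacent G x w") auto
    qed
  qed
qed

lemma signed_graph_t_transform:
  assumes "signed_graph G" "adjacent G x y"
  shows "signed_graph (t_transform G x y)"
proof -
  note adj = signed_graph_adjacentD[OF assms(1)]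
  have *: "{x, v} \<subseteq> verts G \<and> card {x, v} = 2" if "v \<noteq> x" "adjacent G y v" for v
    using adj[OF that(2)] adj[OF assms(2)] that(1) by auto
  have sg: "esign G e = 1 \<or> esign G e = -1" if "e \<in> edges G" for e
    using assms(1) that by (auto simp: signed_graph_def)
  have ins: "insert y ({x, v} - {x}) = {y, v}" if "v \<noteq> x" for v
    using that by auto
  have fin: "finite (verts G)" and ed: "\<And>e. e \<in> edges G \<Longrightarrow> e \<subseteq> verts G \<and> card e = 2"
    using assms(1) by (auto simp: signed_graph_def simple_graph_def)
  have "simple_graph (t_transform G x y)"
    unfolding simple_graph_def
  proof (intro conjI ballI)
    show "finite (verts (t_transform G x y))" using fin by simp
  next
    fix e assume "e \<in> edges (t_transform G x y)"
    then have "e \<in> edges G \<or> (\<exists>v. e = {x, v} \<and> v \<noteq> x \<and> adjacent G y v)"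
      by (auto simp: t_transform_def Let_def)
    then show "e \<subseteq> verts (t_transform G x y)" "card e = 2" using * ed by auto
  qed
  moreover have "esign (t_transform G x y) e \<in> {1, -1}" if "e \<in> edges (t_transform G x y)" for e
  proof -
    define S where "S = {{x, v} | v. v \<noteq> x \<and> adjacent G y v}"
    have H: "esign (t_transform G x y) e = (if e = {x, y} then - esign G {x, y} else if e \<in> S then
        (if esign G {x, y} = -1 then esign G (insert y (e - {x}))
         else - esign G (insert y (e - {x}))) else esign G e)"
      by (simp add: t_transform_def Let_def S_def)
    have "esign G (insert y (e - {x})) = 1 \<or> esign G (insert y (e - {x})) = -1" if "e \<in> S"
    proof -
      obtain v where v: "e = {x, v}" "v \<noteq> x" "adjacent G y v"
        using \<open>e \<in> S\<close> unfolding S_def by blast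
      then show ?thesis using sg[OF v(3)] ins[OF v(2)] by simp
    qed
    moreover have "esign G e = 1 \<or> esign G e = -1" if "e \<notin> S"
      using sg \<open>e \<in> edges (t_transform G x y)\<close> that by (auto simp add: t_transform_def Let_def S_def)
    ultimately show ?thesis
      using sg[OF assms(2)] unfolding H by auto
  qed
  ultimately show ?thesis
    by (auto simp: signed_graph_def)
qed

text \<open>The \<open>t\<close>-move changes the basis, not the form: the new form at \<open>z\<close> is the old form at the vector
  \<open>z'\<close> obtained by expanding the reflected basis vector.\<close>
lemma positive_graph_t_transform:
  assumes "signed_graph G" "positive_graph G" "adjacent G x y"
  shows "positive_graph (t_transform G x y)"
  unfolding positive_graph_gram positive_definite_on_def verts_t_transform
proof (intro allI impI)
  fix z :: "'a \<Rightarrow> real"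
  assume nz: "\<exists>v\<in>verts G. z v \<noteq> 0"
  define V where "V = verts G"
  define H where "H = t_transform G x y"
  define g h where "g u w = real_of_int (gram G u w)" and "h u w = real_of_int (gram H u w)" for u w
  define \<epsilon> where "\<epsilon> = g x y"
  note adj = signed_graph_adjacentD[OF assms(1,3)]
  have V: "finite V" "x \<in> V" "y \<in> V"
    using assms(1) adj by (auto simp: V_def signed_graph_def simple_graph_def)
  have gyy: "g y y = 2" "g x x = 2" "h x x = 2"
    using gram_self[OF assms(1)] gram_self[OF signed_graph_t_transform[OF assms(1,3)]]
    by (auto simp: g_def h_def H_def)
  have gc: "g u w = g w u" and hc: "h u w = h w u" for u w
    using gram_commute by (auto simp: g_def h_def)
  have \<epsilon>: "\<epsilon> * \<epsilon> = 1"
    using gram_range[OF assms(1) adj(1)] adjacent_iff_gram[OF assms(1) adj(1)] assms(3)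
    by (auto simp: \<epsilon>_def g_def)
  have hx: "h x w = g x w - \<epsilon> * g y w" if "w \<noteq> x" for w
    using gram_t_transform_moved[OF assms that] by (simp add: h_def g_def H_def \<epsilon>_def)
  have h: "h u w = g u w - (if u = x then \<epsilon> * g y w else 0) - (if w = x then \<epsilon> * g u y else 0)
      + (if u = x then if w = x then g y y else 0 else 0)" for u w
  proof -
    consider "u = x" "w = x" | "u = x" "w \<noteq> x" | "u \<noteq> x" "w = x" | "u \<noteq> x" "w \<noteq> x" by blast
    then show ?thesis
    proof cases
      case 1
      have "\<epsilon> * g y x = 1" "\<epsilon> * g x y = 1" using \<epsilon> gc[of y x] by (auto simp: \<epsilon>_def)
      then show ?thesis using 1 gyy by simp
    next
      case 2 then show ?thesis using hx by simp
    next
      case 3 then show ?thesis using hx[of u] hc[of u x] gc[of u x] gc[of u y] by simp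
    next
      case 4 then show ?thesis by (simp add: h_def g_def H_def gram_t_transform_other)
    qed
  qed
  have if_sum: "(\<Sum>w\<in>V. if b then f w else 0) = (if b then sum f V else 0)"
    for b and f :: "'a \<Rightarrow> real" by simp
  \<comment> \<open>The coordinates, in the old basis, of the vector with coordinates \<open>z\<close> in the new one.\<close>
  define z' where "z' u = z u - (if u = y then \<epsilon> * z x else 0)" for u
  have "\<exists>v\<in>V. z' v \<noteq> 0"
  proof (rule ccontr)
    assume "\<not> (\<exists>v\<in>V. z' v \<noteq> 0)"
    then have 0: "z' v = 0" if "v \<in> V" for v using that by blast
    from 0[of x] have "z x = 0" using V adj(1) by (simp add: z'_def)
    then show False using 0 nz by (auto simp: z'_def V_def split: if_splits)
  qed
  then have "0 < (\<Sum>u\<in>V. \<Sum>w\<in>V. z' u * g u w * z' w)"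
    using assms(2) by (auto simp: positive_graph_gram positive_definite_on_def V_def g_def)
  also have "(\<Sum>u\<in>V. \<Sum>w\<in>V. z' u * g u w * z' w) = (\<Sum>u\<in>V. \<Sum>w\<in>V. z u * g u w * z w)
      - (\<Sum>w\<in>V. \<epsilon> * z x * g y w * z w) - (\<Sum>u\<in>V. \<epsilon> * z x * g u y * z u)
      + \<epsilon> * \<epsilon> * z x * z x * g y y"
  proof -
    have "z' u * g u w * z' w = z u * g u w * z w
        - (if u = y then \<epsilon> * z x * g y w * z w else 0) - (if w = y then \<epsilon> * z x * g u y * z u else 0)
        + (if u = y then if w = y then \<epsilon> * \<epsilon> * z x * z x * g y y else 0 else 0)" for u w
      by (simp add: z'_def algebra_simps)
    then show ?thesis
      using V by (simp add: sum.distrib sum_subtractf if_sum)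
  qed
  also have "\<dots> = (\<Sum>u\<in>V. \<Sum>w\<in>V. z u * h u w * z w)"
  proof -
    have "z u * h u w * z w = z u * g u w * z w
        - (if u = x then \<epsilon> * z x * g y w * z w else 0) - (if w = x then \<epsilon> * z x * g u y * z u else 0)
        + (if u = x then if w = x then \<epsilon> * \<epsilon> * z x * z x * g y y else 0 else 0)" for u w
      using \<epsilon> by (simp add: h algebra_simps)
    then show ?thesis
      using V by (simp add: sum.distrib sum_subtractf if_sum)
  qed
  finally show "0 < (\<Sum>v\<in>verts G. \<Sum>w\<in>verts G. z v * real_of_int (gram (t_transform G x y) v w) * z w)"
    by (simp add: V_def h_def H_def)
qed

text \<open>Connectedness in terms of cuts.  A cut of the transformed graph without crossing edges is
  one of the original graph as well, so this form passes through a \<open>t\<close>-move without any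
  discussion of paths; it is also what enlarging a connected subgraph by one vertex uses.\<close>
definition cut_connected :: "('a, 'm) ugraph_scheme \<Rightarrow> bool" where
  "cut_connected G \<longleftrightarrow>
     (\<forall>P. P \<subseteq> verts G \<and> P \<noteq> {} \<and> P \<noteq> verts G \<longrightarrow> (\<exists>u\<in>P. \<exists>w\<in>verts G - P. adjacent G u w))"

lemma connected_graph_cut_connected:
  assumes "simple_graph G" "connected_graph G"
  shows "cut_connected G"
  unfolding cut_connected_def
proof (intro allI impI, rule ccontr)
  fix P assume P: "P \<subseteq> verts G \<and> P \<noteq> {} \<and> P \<noteq> verts G"
    and no: "\<not> (\<exists>u\<in>P. \<exists>w\<in>verts G - P. adjacent G u w)"
  from P obtain a b where ab: "a \<in> P" "b \<in> verts G - P" by blast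
  then have "(adjacent G)\<^sup>*\<^sup>* a b"
    using assms(2) P by (auto simp: connected_graph_def)
  then have "b \<in> P"
  proof (induction rule: rtranclp_induct)
    case (step c d)
    then have "d \<in> verts G" using assms(1) by (auto simp: simple_graph_def)
    then show ?case using step no by blast
  qed (use ab in simp)
  then show False using ab by simp
qed

lemma cut_connected_t_transform:
  assumes "signed_graph G" "positive_graph G" "adjacent G x y" "cut_connected G"
  shows "cut_connected (t_transform G x y)"
  unfolding cut_connected_def verts_t_transform
proof (intro allI impI, rule ccontr)
  let ?H = "t_transform G x y"
  fix P assume P: "P \<subseteq> verts G \<and> P \<noteq> {} \<and> P \<noteq> verts G"
    and no: "\<not> (\<exists>u\<in>P. \<exists>w\<in>verts G - P. adjacent ?H u w)"
  note sH = signed_graph_t_transform[OF assms(1,3)]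
  note adj = signed_graph_adjacentD[OF assms(1,3)]
  have H0: "gram ?H u w = 0" if "u \<in> P" "w \<in> verts G - P" for u w
    using no that adjacent_iff_gram[OF sH, of u w] by blast
  have H0': "gram ?H u w = 0" if "u \<in> verts G - P" "w \<in> P" for u w
    using H0[OF that(2,1)] by (simp add: gram_commute)
  have "gram ?H x y \<noteq> 0"
    using gram_t_transform_moved[OF assms(1-3), of y] adj(1) gram_self[OF assms(1)]
      adjacent_iff_gram[OF assms(1) adj(1)] assms(3) by auto
  then have xy: "x \<in> P \<longleftrightarrow> y \<in> P"
    using H0[of x y] H0'[of x y] adj by auto
  obtain u w where uw: "u \<in> P" "w \<in> verts G - P" "adjacent G u w"
    using assms(4) P unfolding cut_connected_def by blast
  then have nz: "gram G u w \<noteq> 0"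
    using adjacent_iff_gram[OF assms(1), of u w] by blast
  consider "u \<noteq> x" "w \<noteq> x" | "u = x" "w \<noteq> x" | "w = x" "u \<noteq> x" using uw by blast
  then show False
  proof cases
    case 1
    then show False using nz H0[OF uw(1,2)] gram_t_transform_other[of u x w G y] by simp
  next
    case 2
    then have "gram G y w = gram ?H y w"
      using adj(1) gram_t_transform_other[of y x w G y] by simp
    also have "\<dots> = 0" using 2 uw xy H0 by blast
    finally show False
      using gram_t_transform_moved[OF assms(1-3) 2(2)] nz H0[OF uw(1,2)] 2 by simp
  next
    case 3
    then have "gram G y u = gram ?H y u"
      using adj(1) gram_t_transform_other[of y x u G y] by simp
    also have "\<dots> = 0" using 3 uw xy adj(3) H0' by blast
    finally show False
      using gram_t_transform_moved[OF assms(1-3) 3(2)] nz H0'[OF uw(2,1)] 3 gram_commute[of G u w]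
      by simp
  qed
qed

lemma t_move_invariants:
  assumes "t_move\<^sup>*\<^sup>* G K" "signed_graph G" "positive_graph G"
  shows "signed_graph K \<and> positive_graph K \<and> verts K = verts G \<and> (cut_connected G \<longrightarrow> cut_connected K)"
  using assms
proof (induction rule: rtranclp_induct)
  case (step K L)
  then have K: "signed_graph K" "positive_graph K" "verts K = verts G"
    "cut_connected G \<longrightarrow> cut_connected K" by simp_all
  from step obtain x y where xy: "adjacent K x y" "L = t_transform K x y"
    unfolding t_move_def by blast
  show ?case
    using K signed_graph_t_transform[OF K(1) xy(1)] positive_graph_t_transform[OF K(1,2) xy(1)]
      cut_connected_t_transform[OF K(1,2) xy(1)] by (simp add: xy(2))
qed simp

lemma t_move_transform:
  "signed_graph G \<Longrightarrow> positive_graph G \<Longrightarrow> adjacent G x y \<Longrightarrow> t_move G (t_transform G x y)"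
  using positive_graph_cycles_positive by (auto simp: t_move_def)

section \<open>Making all edges negative\<close>

text \<open>Only \<open>\<alpha>\<^sub>v\<close> is moved, by reflections in the \<open>\<beta>\<^sub>y = s\<^sub>y \<alpha>\<^sub>y\<close> with \<open>y \<in> W\<close>, and only as long as some
  \<open>(\<alpha>\<^sub>v, \<beta>\<^sub>y)\<close> is \<open>1\<close>; such a move subtracts \<open>\<beta>\<^sub>y\<close>.  The process stops for the following reason.
  The accumulated change is \<open>\<Sum>\<^sub>y k\<^sub>y \<beta>\<^sub>y\<close>, and it can be read off from the inner products of \<open>\<alpha>\<^sub>v\<close>
  with the \<open>\<alpha>\<^sub>w\<close>, \<open>w \<in> W\<close>, because the Gram matrix of \<open>W\<close> is nonsingular.  These inner products
  are \<open>-1\<close>, \<open>0\<close> or \<open>1\<close>, so only finitely many \<open>k\<close> occur, whereas every move increases the sum of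
  \<open>k\<close>.  A reachable \<open>k\<close> of maximal sum therefore admits no further move.\<close>
lemma antidominant_vertex:
  fixes G :: "'a sgraph" and s :: "'a \<Rightarrow> int"
  assumes G: "signed_graph G" "positive_graph G"
    and W: "W \<subseteq> verts G" "v \<notin> W"
    and s: "\<And>w. w \<in> W \<Longrightarrow> s w = 1 \<or> s w = -1"
  obtains K where "t_move\<^sup>*\<^sup>* G K"
    and "\<And>u w. u \<in> W \<Longrightarrow> w \<in> W \<Longrightarrow> gram K u w = gram G u w"
    and "\<And>w. w \<in> W \<Longrightarrow> s w * gram K v w \<le> 0"
proof -
  have finW: "finite W"
    using G(1) W finite_subset by (auto simp: signed_graph_def simple_graph_def)
  \<comment> \<open>Setting \<open>k\<close> to \<open>0\<close> outside \<open>W\<close> makes it a function of the inner products.\<close>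
  define reach where "reach k K \<longleftrightarrow> t_move\<^sup>*\<^sup>* G K \<and>
      (\<forall>u\<in>W. \<forall>w\<in>W. gram K u w = gram G u w) \<and>
      (\<forall>w\<in>W. gram K v w = gram G v w - (\<Sum>y\<in>W. k y * s y * gram G y w)) \<and>
      (\<forall>y. y \<notin> W \<longrightarrow> k y = 0)" for k :: "'a \<Rightarrow> int" and K
  define Ks where "Ks = {k. \<exists>K. reach k K}"
  define row where "row k w = (if w \<in> W then gram G v w - (\<Sum>y\<in>W. k y * s y * gram G y w) else 0)"
    for k w
  have "inj_on row Ks"
  proof (rule inj_onI)
    fix k k' assume k: "k \<in> Ks" "k' \<in> Ks" and eq: "row k = row k'"
    define d where "d y = (k y - k' y) * s y" for y
    have 0: "(\<Sum>y\<in>W. d y * gram G y w) = 0" if "w \<in> W" for w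
      using fun_cong[OF eq, of w] that by (simp add: row_def d_def sum_subtractf algebra_simps)
    \<comment> \<open>The combination of the \<open>\<alpha>\<^sub>y\<close> with coefficients \<open>d\<close> is orthogonal to all of them,
      hence to itself.\<close>
    have "(\<Sum>y\<in>W. \<Sum>w\<in>W. d y * gram G y w * d w) = (\<Sum>w\<in>W. (\<Sum>y\<in>W. d y * gram G y w) * d w)"
      by (subst sum.swap) (simp add: sum_distrib_right)
    also have "\<dots> = 0" using 0 by simp
    finally have "real_of_int (\<Sum>y\<in>W. \<Sum>w\<in>W. d y * gram G y w * d w) = 0" by simp
    moreover have "positive_definite_on W (\<lambda>v w. real_of_int (gram G v w))"
      using G W by (auto simp: positive_graph_gram signed_graph_def simple_graph_def
                          intro: positive_definite_on_subset)
    ultimately have "\<forall>w\<in>W. d w = 0"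
      unfolding positive_definite_on_def
      by (auto dest: spec[of _ "\<lambda>w. real_of_int (d w)"])
    then have "k w = k' w" if "w \<in> W" for w
      using that s[of w] by (auto simp: d_def)
    moreover have "k w = k' w" if "w \<notin> W" for w
      using that k by (auto simp: Ks_def reach_def)
    ultimately show "k = k'" by blast
  qed
  moreover have "row ` Ks \<subseteq> {f. \<forall>w. (w \<in> W \<longrightarrow> f w \<in> {-1, 0, 1}) \<and> (w \<notin> W \<longrightarrow> f w = 0)}"
  proof clarify
    fix k w assume "k \<in> Ks"
    then obtain K where K: "reach k K" by (auto simp: Ks_def)
    then have "signed_graph K" using t_move_invariants G by (auto simp: reach_def)
    then have "gram K v w \<in> {-1, 0, 1}" if "w \<in> W"
      using gram_range that W by metis
    then show "(w \<in> W \<longrightarrow> row k w \<in> {-1, 0, 1}) \<and> (w \<notin> W \<longrightarrow> row k w = 0)"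
      using K by (auto simp: reach_def row_def)
  qed
  moreover have "finite {f. \<forall>w. (w \<in> W \<longrightarrow> f w \<in> {-1, 0, 1::int}) \<and> (w \<notin> W \<longrightarrow> f w = 0)}"
    by (rule finite_set_of_finite_funs) (use finW in auto)
  ultimately have "finite Ks"
    using finite_imageD finite_subset by blast
  moreover have "reach (\<lambda>_. 0) G" by (simp add: reach_def)
  then have "Ks \<noteq> {}" by (auto simp: Ks_def)
  ultimately have "\<exists>k\<in>Ks. \<forall>k'\<in>Ks. sum k' W \<le> sum k W"
    using Max_in[of "(\<lambda>k. sum k W) ` Ks"] Max_ge[of "(\<lambda>k. sum k W) ` Ks"] by fastforce
  then obtain k K where K: "reach k K" and max: "\<And>k' K'. reach k' K' \<Longrightarrow> sum k' W \<le> sum k W"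
    by (auto simp: Ks_def)
  have inv: "signed_graph K" "positive_graph K" "verts K = verts G"
    using t_move_invariants K G by (auto simp: reach_def)
  have "s y * gram K v y \<le> 0" if y: "y \<in> W" for y
  proof (rule ccontr)
    assume "\<not> s y * gram K v y \<le> 0"
    moreover have vy: "v \<noteq> y" using W y by blast
    ultimately have g: "gram K v y = s y"
      using gram_range[OF inv(1) vy] s[OF y] by auto
    then have adj: "adjacent K v y"
      using adjacent_iff_gram[OF inv(1) vy] s[OF y] by auto
    define L where "L = t_transform K v y"
    have 1: "t_move\<^sup>*\<^sup>* G L"
      using K t_move_transform[OF inv(1,2) adj] by (auto simp: reach_def L_def)
    have 2: "gram L u w = gram G u w" if "u \<in> W" "w \<in> W" for u w
    proof -
      have "u \<noteq> v" "w \<noteq> v" using that W by auto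
      then show ?thesis
        using that K gram_t_transform_other[of u v w K y] by (auto simp: reach_def L_def)
    qed
    have 3: "gram L v w = gram G v w - (\<Sum>u\<in>W. (k(y := k y + 1)) u * s u * gram G u w)"
      if "w \<in> W" for w
    proof -
      have "w \<noteq> v" using that W by auto
      then have "gram L v w = gram K v w - s y * gram G y w"
        using gram_t_transform_moved[OF inv(1,2) adj] g K y that by (auto simp: L_def reach_def)
      moreover have "(\<Sum>u\<in>W. (k(y := k y + 1)) u * s u * gram G u w) =
          (\<Sum>u\<in>W. k u * s u * gram G u w + (if u = y then s y * gram G y w else 0))"
        by (intro sum.cong) (auto simp: algebra_simps)
      ultimately show ?thesis
        using K that y finW by (simp add: reach_def sum.distrib)
    qed
    have "reach (k(y := k y + 1)) L"
      using 1 2 3 K y unfolding reach_def by auto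
    from max[OF this] have "sum (k(y := k y + 1)) W \<le> sum k W" .
    moreover have "sum (k(y := k y + 1)) W = (\<Sum>u\<in>W. k u + (if u = y then 1 else 0))"
      by (intro sum.cong) auto
    ultimately show False
      using y finW by (simp add: sum.distrib)
  qed
  with K that show ?thesis by (auto simp: reach_def)
qed

text \<open>The function \<open>s\<close> replaces some \<open>\<alpha>\<^sub>u\<close> by \<open>- \<alpha>\<^sub>u\<close>, which affects only signs of edges.  The vertices
  are treated one after the other; making a new vertex antidominant leaves the inner products
  among the previous ones unchanged.\<close>
lemma t_equivalent_nonpositive:
  assumes G: "signed_graph G" "positive_graph G"
  obtains K and s :: "'a \<Rightarrow> int" where "t_move\<^sup>*\<^sup>* (G :: 'a sgraph) K"
    and "\<And>u. u \<in> verts G \<Longrightarrow> s u = 1 \<or> s u = -1"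
    and "\<And>u w. u \<in> verts G \<Longrightarrow> w \<in> verts G \<Longrightarrow> u \<noteq> w \<Longrightarrow> s u * s w * gram K u w \<le> 0"
proof -
  have fin: "finite (verts G)" using G by (simp add: signed_graph_def simple_graph_def)
  have *: "\<exists>K s. t_move\<^sup>*\<^sup>* G K \<and> (\<forall>u\<in>W. s u = 1 \<or> s u = (-1::int)) \<and>
      (\<forall>u\<in>W. \<forall>w\<in>W. u \<noteq> w \<longrightarrow> s u * s w * gram K u w \<le> 0)" if "finite W" "W \<subseteq> verts G" for W
    using that
  proof (induction rule: finite_induct)
    case (insert v W)
    then obtain K s where K: "t_move\<^sup>*\<^sup>* G K" and s: "\<forall>u\<in>W. s u = 1 \<or> s u = (-1::int)"
      and neg: "\<forall>u\<in>W. \<forall>w\<in>W. u \<noteq> w \<longrightarrow> s u * s w * gram K u w \<le> 0" by auto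
    have inv: "signed_graph K" "positive_graph K" "verts K = verts G"
      using t_move_invariants[OF K G] by auto
    obtain L where L: "t_move\<^sup>*\<^sup>* K L" "\<And>u w. u \<in> W \<Longrightarrow> w \<in> W \<Longrightarrow> gram L u w = gram K u w"
      "\<And>w. w \<in> W \<Longrightarrow> s w * gram L v w \<le> 0"
      using antidominant_vertex[OF inv(1,2), of W v s] inv(3) insert s by blast
    define s' where "s' = s(v := 1)"
    have "t_move\<^sup>*\<^sup>* G L" using K L(1) by simp
    moreover have "s' u * s' w * gram L u w \<le> 0"
      if uw: "u \<in> insert v W" "w \<in> insert v W" "u \<noteq> w" for u w
    proof -
      consider "u \<in> W" "w \<in> W" | "u = v" "w \<in> W" | "w = v" "u \<in> W" using uw by blast
      then show ?thesis
        using neg L(2,3) \<open>v \<notin> W\<close> uw(3) gram_commute[of L u v] by cases (auto simp: s'_def)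
    qed
    moreover have "\<forall>u\<in>insert v W. s' u = 1 \<or> s' u = -1"
      using s by (simp add: s'_def)
    ultimately show ?case by blast
  qed auto
  from *[OF fin] obtain K s where "t_move\<^sup>*\<^sup>* G K" "\<forall>u\<in>verts G. s u = 1 \<or> s u = (-1::int)"
    "\<forall>u\<in>verts G. \<forall>w\<in>verts G. u \<noteq> w \<longrightarrow> s u * s w * gram K u w \<le> 0" by auto
  then show ?thesis by (intro that[of K s]) simp_all
qed

section \<open>Graphs of finite type and extended Dynkin diagrams\<close>

text \<open>These are the positive signed graphs with all edges negative; the matrix \<open>2I - A\<close> is then a
  Cartan matrix of finite type.\<close>
locale finite_type_graph =
  fixes V :: "'a set" and adj :: "'a \<Rightarrow> 'a \<Rightarrow> bool"
  assumes finite_V: "finite V"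
    and adj_sym: "adj u w \<Longrightarrow> adj w u"
    and adj_irrefl: "\<not> adj u u"
    and cartan_positive_definite:
      "positive_definite_on V (\<lambda>u w. if u = w then 2 else if adj u w then -1 else 0)"
begin

definition cartan :: "'a \<Rightarrow> 'a \<Rightarrow> real" where
  "cartan u w = (if u = w then 2 else if adj u w then -1 else 0)"

lemma cartan_positive:
  assumes "S \<subseteq> V" "\<exists>v\<in>S. x v \<noteq> 0"
  shows "0 < (\<Sum>v\<in>S. \<Sum>w\<in>S. x v * cartan v w * x w)"
  using positive_definite_on_subset[OF cartan_positive_definite finite_V assms(1)] assms(2)
  unfolding cartan_def positive_definite_on_def by blast

text \<open>A positive function \<open>c\<close> on a subgraph with twice the value at each vertex bounded by the sum
  over its neighbours makes the form nonpositive, as \<open>c\<^sub>i (2 c\<^sub>i - \<Sum> c\<^sub>j) \<le> 0\<close> for each \<open>i\<close>.  Since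
  \<open>c\<close> is positive, neighbours may be left out of \<open>nb i\<close>; thus the subgraph need not be
  induced.\<close>
lemma no_subharmonic:
  fixes c :: "'i \<Rightarrow> real" and nb :: "'i \<Rightarrow> 'i set"
  assumes "finite I" "I \<noteq> {}" "inj_on p I" "p ` I \<subseteq> V"
    and pos: "\<And>i. i \<in> I \<Longrightarrow> 0 < c i"
    and nb: "\<And>i. i \<in> I \<Longrightarrow> nb i \<subseteq> I" "\<And>i j. i \<in> I \<Longrightarrow> j \<in> nb i \<Longrightarrow> adj (p i) (p j)"
    and sub: "\<And>i. i \<in> I \<Longrightarrow> 2 * c i \<le> sum c (nb i)"
  shows False
proof -
  define x where "x v = c (the_inv_into I p v)" for v
  have x: "x (p i) = c i" if "i \<in> I" for i
    using that by (simp add: x_def the_inv_into_f_f assms(3))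
  obtain i0 where "i0 \<in> I" using assms(2) by blast
  then have "\<exists>v\<in>p ` I. x v \<noteq> 0"
    using x pos[of i0] by (intro bexI[of _ "p i0"]) auto
  then have "0 < (\<Sum>v\<in>p ` I. \<Sum>w\<in>p ` I. x v * cartan v w * x w)"
    using cartan_positive[OF assms(4)] by blast
  also have "\<dots> = (\<Sum>i\<in>I. \<Sum>j\<in>I. c i * cartan (p i) (p j) * c j)"
    using assms(3) x by (simp add: sum.reindex)
  also have "\<dots> \<le> 0"
  proof (rule sum_nonpos)
    fix i assume i: "i \<in> I"
    have "i \<notin> nb i" using nb(2)[OF i] adj_irrefl by blast
    have "sum c (nb i) = (\<Sum>j\<in>I. if j \<in> nb i then c j else 0)"
      using nb(1)[OF i] assms(1) by (simp add: sum.inter_restrict[symmetric] Int_absorb1)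
    then have "(\<Sum>j\<in>I. (if i = j then 2 * c i else 0) - (if j \<in> nb i then c j else 0)) \<le> 0"
      using sub[OF i] assms(1) i by (simp add: sum_subtractf)
    moreover have "(\<Sum>j\<in>I. cartan (p i) (p j) * c j) \<le>
        (\<Sum>j\<in>I. (if i = j then 2 * c i else 0) - (if j \<in> nb i then c j else 0))"
    proof (rule sum_mono)
      fix j assume j: "j \<in> I"
      have "p i = p j \<longleftrightarrow> i = j" using assms(3) i j by (auto dest: inj_onD)
      then show "cartan (p i) (p j) * c j \<le> (if i = j then 2 * c i else 0) - (if j \<in> nb i then c j else 0)"
        using nb(2)[OF i, of j] \<open>i \<notin> nb i\<close> pos[OF j] by (auto simp: cartan_def)
    qed
    ultimately have "(\<Sum>j\<in>I. cartan (p i) (p j) * c j) \<le> 0" by linarith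
    then have "c i * (\<Sum>j\<in>I. cartan (p i) (p j) * c j) \<le> 0"
      using pos[OF i] by (simp add: mult_le_0_iff)
    then show "(\<Sum>j\<in>I. c i * cartan (p i) (p j) * c j) \<le> 0"
      by (simp add: sum_distrib_left mult.assoc)
  qed
  finally show False by simp
qed

text \<open>The extended diagrams are excluded by the function spanning the radical of their form.  Here
  the diagram is a path \<open>1, \<dots>, k + 1\<close> with two more vertices \<open>k + 2\<close> and \<open>0\<close> attached to
  the second vertex from either end; for \<open>k = 2\<close> it is a star with four leaves.  The function is \<open>2\<close>
  on the inner path \<open>2, \<dots>, k\<close> and \<open>1\<close> on the four leaves.\<close>
lemma no_D_tilde:
  fixes p :: "nat \<Rightarrow> 'a"
  assumes k: "2 \<le> k" and inj: "inj_on p {0..k + 2}" and V: "p ` {0..k + 2} \<subseteq> V"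
    and path: "\<And>i. 1 \<le> i \<Longrightarrow> i \<le> k \<Longrightarrow> adj (p i) (p (Suc i))"
    and branches: "adj (p 2) (p (k + 2))" "adj (p k) (p 0)"
  shows False
proof (rule no_subharmonic[OF _ _ inj V])
  define c :: "nat \<Rightarrow> real" where "c i = (if 2 \<le> i \<and> i \<le> k then 2 else 1)" for i
  define nb where "nb i = (if i = 0 then {k} else if i = k + 2 then {2} else if i = 1 then {2}
      else if i = k + 1 then {k}
      else if k = 2 then {1, 3, 0, 4} else if i = 2 then {1, 3, k + 2}
      else if i = k then {k - 1, k + 1, 0} else {i - 1, i + 1})" for i
  fix i assume i: "i \<in> {0..k + 2}"
  then have range: "0 \<le> i" "i \<le> k + 2" by auto
  show "0 < c i" by (simp add: c_def)
  show "nb i \<subseteq> {0..k + 2}" using range k by (auto simp: nb_def)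
  show "2 * c i \<le> sum c (nb i)"
    using range k by (auto simp: nb_def c_def)
  have path': "adj (p i) (p j)" if "j = Suc i \<and> 1 \<le> i \<and> i \<le> k \<or> i = Suc j \<and> 1 \<le> j \<and> j \<le> k" for i j
    using that path adj_sym by blast
  show "adj (p i) (p j)" if "j \<in> nb i" for j
  proof -
    have "(j = Suc i \<and> 1 \<le> i \<and> i \<le> k \<or> i = Suc j \<and> 1 \<le> j \<and> j \<le> k) \<or>
      (i = 2 \<and> j = k + 2) \<or> (i = k + 2 \<and> j = 2) \<or> (i = k \<and> j = 0) \<or> (i = 0 \<and> j = k)"
      using that range k by (auto simp: nb_def split: if_splits)
    then show ?thesis
      using path' branches adj_sym by blast
  qed
qed (use k in auto)

lemma no_weighted_subgraph:
  fixes cs :: "real list" and nbs :: "nat set list"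
  assumes "distinct vs" "set vs \<subseteq> V" "vs \<noteq> []"
    and "\<forall>i<length vs. 0 < cs ! i \<and> (\<forall>j\<in>nbs ! i. j < length vs \<and> adj (vs ! i) (vs ! j)) \<and>
           2 * cs ! i \<le> (\<Sum>j\<in>nbs ! i. cs ! j)"
  shows False
proof (rule no_subharmonic[of "{..<length vs}" "(!) vs" "(!) cs" "(!) nbs"])
  show "inj_on ((!) vs) {..<length vs}" using assms(1) by (simp add: inj_on_nth)
  show "(!) vs ` {..<length vs} \<subseteq> V" using assms(2) by (auto dest: nth_mem)
qed (use assms in auto)

text \<open>In the three exceptional extended diagrams the list \<open>vs\<close> starts with the vertices of a longest
  path; the remaining ones form the third arm.\<close>
lemma no_E6_tilde:
  assumes "distinct vs" "set vs \<subseteq> V" "length vs = 7"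
    and "\<forall>i<4. adj (vs ! i) (vs ! Suc i)" "adj (vs ! 2) (vs ! 5)" "adj (vs ! 5) (vs ! 6)"
  shows False
  by (rule no_weighted_subgraph[of vs "[1, 2, 3, 2, 1, 2, 1]"
        "[{1}, {0, 2}, {1, 3, 5}, {2, 4}, {3}, {2, 6}, {5}]"])
    (use assms adj_sym in \<open>auto simp: All_less_Suc eval_nat_numeral\<close>)

lemma no_E7_tilde:
  assumes "distinct vs" "set vs \<subseteq> V" "length vs = 8"
    and "\<forall>i<6. adj (vs ! i) (vs ! Suc i)" "adj (vs ! 3) (vs ! 7)"
  shows False
  by (rule no_weighted_subgraph[of vs "[1, 2, 3, 4, 3, 2, 1, 2]"
        "[{1}, {0, 2}, {1, 3}, {2, 4, 7}, {3, 5}, {4, 6}, {5}, {3}]"])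
    (use assms adj_sym in \<open>auto simp: All_less_Suc eval_nat_numeral\<close>)

lemma no_E8_tilde:
  assumes "distinct vs" "set vs \<subseteq> V" "length vs = 9"
    and "\<forall>i<7. adj (vs ! i) (vs ! Suc i)" "adj (vs ! 2) (vs ! 8)"
  shows False
  by (rule no_weighted_subgraph[of vs "[2, 4, 6, 5, 4, 3, 2, 1, 3]"
        "[{1}, {0, 2}, {1, 3, 8}, {2, 4}, {3, 5}, {4, 6}, {5, 7}, {6}, {2}]"])
    (use assms adj_sym in \<open>auto simp: All_less_Suc eval_nat_numeral\<close>)

end

section \<open>Attaching one vertex to a Dynkin diagram\<close>

lemma path_edges_iff:
  "{i, j} \<in> path_edges m \<longleftrightarrow> j = Suc i \<and> 1 \<le> i \<and> i < m \<or> i = Suc j \<and> 1 \<le> j \<and> j < m"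
  by (auto simp: path_edges_def doubleton_eq_iff)

context finite_type_graph
begin

definition induced_copy :: "nat ugraph \<Rightarrow> (nat \<Rightarrow> 'a) \<Rightarrow> 'a set \<Rightarrow> bool" where
  "induced_copy D g W \<longleftrightarrow> bij_betw g (verts D) W \<and>
     (\<forall>i\<in>verts D. \<forall>j\<in>verts D. adj (g i) (g j) \<longleftrightarrow> adjacent D i j)"

definition dynkin_on :: "'a set \<Rightarrow> bool" where
  "dynkin_on W \<longleftrightarrow> (\<exists>g n. (1 \<le> n \<and> induced_copy (dynkin_A n) g W) \<or> (4 \<le> n \<and> induced_copy (dynkin_D n) g W) \<or>
     (n \<in> {6, 7, 8} \<and> induced_copy (dynkin_E n) g W))"

end

text \<open>The labels of \<open>D\<close> start at \<open>1\<close>, which leaves the label \<open>0\<close> for the new vertex \<open>v\<close> in the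
  labelling \<open>h\<close> below.\<close>
locale attached_vertex = finite_type_graph +
  fixes D :: "nat ugraph" and n k :: nat and g :: "nat \<Rightarrow> 'a" and W :: "'a set" and v :: 'a
  assumes W: "W \<subseteq> V" and v: "v \<in> V" "v \<notin> W"
    and verts_D: "verts D = {1..n}"
    and copy_g: "induced_copy D g W"
    and k: "1 \<le> k" "k \<le> n"
    and adj_v: "\<And>i. 1 \<le> i \<Longrightarrow> i \<le> n \<Longrightarrow> adj v (g i) \<longleftrightarrow> i = k"
begin

definition h :: "nat \<Rightarrow> 'a" where "h = g(0 := v)"

lemma bij_h: "bij_betw h {0..n} (insert v W)"
proof -
  have "bij_betw g {1..n} W" using copy_g verts_D by (simp add: induced_copy_def)
  then have "bij_betw h {1..n} W"
    by (rule bij_betw_cong[THEN iffD1, rotated]) (simp add: h_def)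
  moreover have "bij_betw h {0} {v}" by (simp add: h_def bij_betw_def)
  ultimately have "bij_betw h ({0} \<union> {1..n}) ({v} \<union> W)"
    using v by (intro bij_betw_combine) auto
  moreover have "{0} \<union> {1..n} = {0..n}" by auto
  ultimately show ?thesis by simp
qed

lemma adj_h:
  assumes "i \<le> n" "j \<le> n"
  shows "adj (h i) (h j) \<longleftrightarrow>
    (if i = 0 then j = k else if j = 0 then i = k else adjacent D i j)"
  using assms adj_v k copy_g verts_D adj_irrefl adj_sym[of _ v] adj_sym[of v]
  unfolding induced_copy_def h_def by (auto simp: Suc_le_eq)

text \<open>Reduces the recognition of the enlarged diagram as \<open>D'\<close> to arithmetic with labels: \<open>\<pi>\<close> sends
  each label of \<open>D'\<close> to a label of \<open>D\<close> or to the label \<open>0\<close> of \<open>v\<close>.\<close>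
lemma relabel:
  assumes "verts D' = {1..Suc n}" "inj_on \<pi> {1..Suc n}" "\<pi> ` {1..Suc n} \<subseteq> {0..n}"
    and "\<And>i j. 1 \<le> i \<Longrightarrow> i \<le> Suc n \<Longrightarrow> 1 \<le> j \<Longrightarrow> j \<le> Suc n \<Longrightarrow> adjacent D' i j \<longleftrightarrow>
      (if \<pi> i = 0 then \<pi> j = k else if \<pi> j = 0 then \<pi> i = k else adjacent D (\<pi> i) (\<pi> j))"
  shows "induced_copy D' (h \<circ> \<pi>) (insert v W)"
  unfolding induced_copy_def
proof
  have "\<pi> ` {1..Suc n} = {0..n}"
    by (rule card_subset_eq) (use assms(2,3) in \<open>simp_all add: card_image\<close>)
  then have "bij_betw \<pi> {1..Suc n} {0..n}"
    using assms(2) by (simp add: bij_betw_def)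
  then show "bij_betw (h \<circ> \<pi>) (verts D') (insert v W)"
    unfolding assms(1) using bij_h by (rule bij_betw_trans)
  have "\<pi> i \<le> n" if "1 \<le> i" "i \<le> Suc n" for i
    using that assms(3) by force
  then show "\<forall>i\<in>verts D'. \<forall>j\<in>verts D'. adj ((h \<circ> \<pi>) i) ((h \<circ> \<pi>) j) \<longleftrightarrow> adjacent D' i j"
    unfolding assms(1) by (auto simp: adj_h assms(4))
qed

lemma distinct_map_h: "distinct xs \<Longrightarrow> set xs \<subseteq> {0..n} \<Longrightarrow> distinct (map h xs)"
  using bij_h by (auto simp: distinct_map bij_betw_def intro: inj_on_subset)

lemma h_in_V: "i \<le> n \<Longrightarrow> h i \<in> V"
  using bij_h W v(1) by (force simp: bij_betw_def)

lemma no_D_tilde_h: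
  assumes "2 \<le> m" "inj_on q {0..m + 2}" "q ` {0..m + 2} \<subseteq> {0..n}"
    and "\<And>i. 1 \<le> i \<Longrightarrow> i \<le> m \<Longrightarrow> adj (h (q i)) (h (q (Suc i)))"
    and "adj (h (q 2)) (h (q (m + 2)))" "adj (h (q m)) (h (q 0))"
  shows False
proof (rule no_D_tilde[of m "h \<circ> q"])
  show "inj_on (h \<circ> q) {0..m + 2}"
    using assms(2,3) bij_h by (auto simp: bij_betw_def intro: comp_inj_on inj_on_subset)
  show "(h \<circ> q) ` {0..m + 2} \<subseteq> V"
    using assms(3) h_in_V by (auto simp: image_subset_iff)
qed (use assms in simp_all)

end

context attached_vertex
begin

text \<open>Attaching \<open>v\<close> to a path creates at most three arms, of which \<open>v\<close> alone is one.  The bound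
  on \<open>k\<close> costs no generality because a path can be reversed.  For
  \<open>k \<ge> 4\<close> both other arms have at least three vertices, which gives the extended diagram of \<open>E\<^sub>7\<close>; for
  \<open>k = 3\<close> they have two and \<open>n - 3\<close>, and the extended diagram of \<open>E\<^sub>8\<close> appears at \<open>n = 8\<close>.\<close>
lemma extend_A:
  assumes D: "D = dynkin_A n" and half: "2 * k \<le> Suc n"
  shows "dynkin_on (insert v W)"
proof -
  have adj_D: "adjacent D i j \<longleftrightarrow> j = Suc i \<and> 1 \<le> i \<and> i < n \<or> i = Suc j \<and> 1 \<le> j \<and> j < n" for i j
    by (simp add: D dynkin_A_def path_edges_iff)
  consider "k = 1" | "k = 2" | "k = 3" "n \<le> 7" | "k = 3" "8 \<le> n" | "4 \<le> k" using k by linarith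
  then show ?thesis
  proof cases
    case 1
    have "induced_copy (dynkin_A (Suc n)) (h \<circ> (\<lambda>i. i - 1)) (insert v W)"
    proof (rule relabel)
      show "inj_on (\<lambda>i. i - 1) {1..Suc n}" by (auto simp: inj_on_def)
    qed (use 1 in \<open>auto simp: adj_D dynkin_A_def path_edges_iff\<close>)
    then show ?thesis unfolding dynkin_on_def by (metis le_add1 plus_1_eq_Suc)
  next
    case 2
    let ?\<pi> = "\<lambda>i. if i = Suc n then 0 else i"
    have "induced_copy (dynkin_D (Suc n)) (h \<circ> ?\<pi>) (insert v W)"
    proof (rule relabel)
      show "inj_on ?\<pi> {1..Suc n}" by (auto simp: inj_on_def)
    qed (use 2 k half in \<open>auto simp: adj_D dynkin_D_def path_edges_iff doubleton_eq_iff\<close>)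
    moreover have "4 \<le> Suc n" using 2 half by simp
    ultimately show ?thesis unfolding dynkin_on_def by blast
  next
    case 3
    let ?\<pi> = "\<lambda>i. if i = Suc n then 0 else i"
    have "induced_copy (dynkin_E (Suc n)) (h \<circ> ?\<pi>) (insert v W)"
    proof (rule relabel)
      show "inj_on ?\<pi> {1..Suc n}" by (auto simp: inj_on_def)
    qed (use 3 k half in \<open>auto simp: adj_D dynkin_E_def path_edges_iff doubleton_eq_iff\<close>)
    moreover have "Suc n \<in> {6, 7, 8}" using 3 half by auto
    ultimately show ?thesis unfolding dynkin_on_def by blast
  next
    case 4
    have False
      by (rule no_E8_tilde[of "map h [1, 2, 3, 4, 5, 6, 7, 8, 0]"], rule distinct_map_h)
        (use 4 h_in_V in \<open>auto simp: All_less_Suc eval_nat_numeral adj_h adj_D\<close>)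
    then show ?thesis ..
  next
    case 5
    have False
      by (rule no_E7_tilde[of "map h [k - 3, k - 2, k - 1, k, k + 1, k + 2, k + 3, 0]"], rule distinct_map_h)
        (use 5 half h_in_V in \<open>auto simp: All_less_Suc eval_nat_numeral adj_h adj_D\<close>)
    then show ?thesis ..
  qed
qed

text \<open>Attaching \<open>v\<close> to the end of the long arm lengthens this arm, and attaching it to an interior
  vertex creates an extended \<open>D\<close> diagram.  On a short arm it produces arms with \<open>1\<close>, \<open>2\<close> and
  \<open>n - 3\<close> vertices besides the branch vertex, hence a diagram of type \<open>E\<close> for \<open>5 \<le> n \<le> 7\<close> and a
  graph containing the extended diagram of \<open>E\<^sub>8\<close> for larger \<open>n\<close>.  The two short arms \<open>1\<close> and \<open>n\<close>
  are interchangeable, so that \<open>k = n\<close> can be left out.\<close>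
lemma extend_D:
  assumes D: "D = dynkin_D n" and n: "4 \<le> n" and "k \<noteq> n"
  shows "dynkin_on (insert v W)"
proof -
  have adj_D: "adjacent D i j \<longleftrightarrow> j = Suc i \<and> 1 \<le> i \<and> i < n - 1 \<or> i = Suc j \<and> 1 \<le> j \<and> j < n - 1 \<or>
      i = 2 \<and> j = n \<or> i = n \<and> j = 2" for i j
    by (auto simp: D dynkin_D_def path_edges_iff doubleton_eq_iff)
  consider "k = n - 1" | "2 \<le> k" "k \<le> n - 2" | "k = 1" "n = 4" | "k = 1" "5 \<le> n" "n \<le> 7"
    | "k = 1" "8 \<le> n" using k n \<open>k \<noteq> n\<close> by linarith
  then show ?thesis
  proof cases
    case 1
    let ?\<pi> = "\<lambda>i. if i = n then 0 else if i = Suc n then n else i"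
    have "induced_copy (dynkin_D (Suc n)) (h \<circ> ?\<pi>) (insert v W)"
    proof (rule relabel)
      show "inj_on ?\<pi> {1..Suc n}" by (auto simp: inj_on_def)
    qed (use 1 n in \<open>auto simp: adj_D dynkin_D_def path_edges_iff doubleton_eq_iff\<close>)
    moreover have "4 \<le> Suc n" using n by simp
    ultimately show ?thesis unfolding dynkin_on_def by blast
  next
    case 2
    have False
      by (rule no_D_tilde_h[of k "\<lambda>i. if i = k + 2 then n else i"])
        (use 2 n in \<open>auto simp: inj_on_def adj_h adj_D\<close>)
    then show ?thesis ..
  next
    case 3
    \<comment> \<open>In \<open>D\<^sub>4\<close> all three arms are alike; the one extended by \<open>v\<close> becomes the long arm of \<open>D\<^sub>5\<close>.\<close>
    let ?\<pi> = "\<lambda>i. if i = 5 then 4 else 4 - i"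
    have "induced_copy (dynkin_D (Suc n)) (h \<circ> ?\<pi>) (insert v W)"
    proof (rule relabel)
      show "inj_on ?\<pi> {1..Suc n}" using 3 by (auto simp: inj_on_def)
    qed (use 3 in \<open>auto simp: adj_D dynkin_D_def path_edges_iff doubleton_eq_iff\<close>)
    moreover have "4 \<le> Suc n" using n by simp
    ultimately show ?thesis unfolding dynkin_on_def by blast
  next
    case 4
    let ?\<pi> = "\<lambda>i. if i = Suc n then n else i - 1"
    have "induced_copy (dynkin_E (Suc n)) (h \<circ> ?\<pi>) (insert v W)"
    proof (rule relabel)
      show "inj_on ?\<pi> {1..Suc n}" using 4 by (auto simp: inj_on_def)
    qed (use 4 in \<open>auto simp: adj_D dynkin_E_def path_edges_iff doubleton_eq_iff\<close>)
    moreover have "Suc n \<in> {6, 7, 8}" using 4 by auto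
    ultimately show ?thesis unfolding dynkin_on_def by blast
  next
    case 5
    have False
      by (rule no_E8_tilde[of "map h [0, 1, 2, 3, 4, 5, 6, 7, n]"], rule distinct_map_h)
        (use 5 h_in_V in \<open>auto simp: All_less_Suc eval_nat_numeral adj_h adj_D\<close>)
    then show ?thesis ..
  qed
qed

text \<open>Only a lengthened arm can lead to a diagram of finite type, and the arms besides the branch
  vertex then have \<open>1\<close>, \<open>2\<close> and at most \<open>4\<close> vertices.  For all other positions of \<open>v\<close> the
  graph contains one of the extended diagrams.\<close>
lemma extend_E:
  assumes D: "D = dynkin_E n" and n: "n \<in> {6, 7, 8}"
  shows "dynkin_on (insert v W)"
proof -
  have adj_D: "adjacent D i j \<longleftrightarrow> j = Suc i \<and> 1 \<le> i \<and> i < n - 1 \<or> i = Suc j \<and> 1 \<le> j \<and> j < n - 1 \<or>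
      i = 3 \<and> j = n \<or> i = n \<and> j = 3" for i j
    by (auto simp: D dynkin_E_def path_edges_iff doubleton_eq_iff)
  have n': "6 \<le> n" "n \<le> 8" using n by auto
  consider "k = 1" "n = 6" | "k = 1" "7 \<le> n" | "k = 2" | "3 \<le> k" "k \<le> n - 2"
    | "k = n - 1" "n \<le> 7" | "k = 7" "n = 8" | "k = n" using k n' by linarith
  then show ?thesis
  proof cases
    case 1
    \<comment> \<open>Both long arms of \<open>E\<^sub>6\<close> have two vertices, so the path is read backwards, ending with
      \<open>v\<close>.\<close>
    let ?\<pi> = "\<lambda>i. if i = 7 then 6 else 6 - i"
    have "induced_copy (dynkin_E (Suc n)) (h \<circ> ?\<pi>) (insert v W)"
    proof (rule relabel)
      show "inj_on ?\<pi> {1..Suc n}" using 1 by (auto simp: inj_on_def)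
    qed (use 1 in \<open>auto simp: adj_D dynkin_E_def path_edges_iff doubleton_eq_iff\<close>)
    moreover have "Suc n \<in> {6, 7, 8}" using 1 by auto
    ultimately show ?thesis unfolding dynkin_on_def by blast
  next
    case 2
    have False
      by (rule no_E7_tilde[of "map h [0, 1, 2, 3, 4, 5, 6, n]"], rule distinct_map_h)
        (use 2 h_in_V in \<open>auto simp: All_less_Suc eval_nat_numeral adj_h adj_D\<close>)
    then show ?thesis ..
  next
    case 3
    \<comment> \<open>The path \<open>4, 3, 2, 1\<close> with \<open>n\<close> attached to \<open>3\<close> and \<open>v\<close> attached to \<open>2\<close>.\<close>
    have False
      by (rule no_D_tilde_h[of 3 "\<lambda>i. if i = 5 then n else if i = 0 then 0 else 5 - i"])
        (use 3 n' in \<open>auto simp: inj_on_def adj_h adj_D\<close>)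
    then show ?thesis ..
  next
    case 4
    have False
      by (rule no_D_tilde_h[of "k - 1" "\<lambda>i. if i = k + 1 then n else if i = 0 then 0 else Suc i"])
        (use 4 n' in \<open>auto simp: inj_on_def adj_h adj_D\<close>)
    then show ?thesis ..
  next
    case 5
    let ?\<pi> = "\<lambda>i. if i = n then 0 else if i = Suc n then n else i"
    have "induced_copy (dynkin_E (Suc n)) (h \<circ> ?\<pi>) (insert v W)"
    proof (rule relabel)
      show "inj_on ?\<pi> {1..Suc n}" by (auto simp: inj_on_def)
    qed (use 5 n' in \<open>auto simp: adj_D dynkin_E_def path_edges_iff doubleton_eq_iff\<close>)
    moreover have "Suc n \<in> {6, 7, 8}" using 5 n' by auto
    ultimately show ?thesis unfolding dynkin_on_def by blast
  next
    case 6
    have False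
      by (rule no_E8_tilde[of "map h [1, 2, 3, 4, 5, 6, 7, 0, 8]"], rule distinct_map_h)
        (use 6 h_in_V in \<open>auto simp: All_less_Suc eval_nat_numeral adj_h adj_D\<close>)
    then show ?thesis ..
  next
    case 7
    have False
      by (rule no_E6_tilde[of "map h [1, 2, 3, 4, 5, n, 0]"], rule distinct_map_h)
        (use 7 n' h_in_V in \<open>auto simp: All_less_Suc eval_nat_numeral adj_h adj_D\<close>)
    then show ?thesis ..
  qed
qed

end

context finite_type_graph
begin

lemma induced_copy_automorphism:
  assumes "induced_copy D g W" "bij_betw \<pi> (verts D) (verts D)"
    and "\<And>i j. i \<in> verts D \<Longrightarrow> j \<in> verts D \<Longrightarrow> adjacent D (\<pi> i) (\<pi> j) \<longleftrightarrow> adjacent D i j"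
  shows "induced_copy D (g \<circ> \<pi>) W"
proof -
  have "\<pi> i \<in> verts D" if "i \<in> verts D" for i
    using assms(2) that by (auto simp: bij_betw_def)
  then show ?thesis
    using assms by (auto simp: induced_copy_def intro: bij_betw_trans)
qed

lemma induced_copy_A_rev:
  assumes "induced_copy (dynkin_A n) g W"
  shows "induced_copy (dynkin_A n) (g \<circ> (\<lambda>i. Suc n - i)) W"
proof (rule induced_copy_automorphism[OF assms])
  show "bij_betw (\<lambda>i. Suc n - i) (verts (dynkin_A n)) (verts (dynkin_A n))"
    by (rule bij_betw_byWitness[where f' = "\<lambda>i. Suc n - i"]) (auto simp: dynkin_A_def)
qed (auto simp: dynkin_A_def path_edges_iff)

lemma induced_copy_D_swap:
  assumes "induced_copy (dynkin_D n) g W" "4 \<le> n"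
  shows "induced_copy (dynkin_D n) (g \<circ> (\<lambda>i. if i = 1 then n else if i = n then 1 else i)) W"
proof (rule induced_copy_automorphism[OF assms(1)])
  let ?\<pi> = "\<lambda>i. if i = 1 then n else if i = n then 1 else i"
  show "bij_betw ?\<pi> (verts (dynkin_D n)) (verts (dynkin_D n))"
    by (rule bij_betw_byWitness[where f' = ?\<pi>]) (use assms(2) in \<open>auto simp: dynkin_D_def\<close>)
qed (use assms(2) in \<open>auto simp: dynkin_D_def path_edges_iff doubleton_eq_iff\<close>)

text \<open>The reversal of \<open>A\<^sub>n\<close> and the exchange of the two short arms of \<open>D\<^sub>n\<close> move the neighbour of \<open>v\<close>
  to one of the positions treated above.\<close>
lemma dynkin_on_insert:
  assumes W: "W \<subseteq> V" and v: "v \<in> V" "v \<notin> W" and dyn: "dynkin_on W"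
    and u: "u \<in> W" "\<And>w. w \<in> W \<Longrightarrow> adj v w \<longleftrightarrow> w = u"
  shows "dynkin_on (insert v W)"
proof -
  have attach: "\<exists>k. attached_vertex V adj D n k g W v \<and> g k = u"
    if "induced_copy D g W" "verts D = {1..n}" for D n g
  proof -
    have bij: "bij_betw g {1..n} W" using that by (simp add: induced_copy_def)
    then obtain k where k: "k \<in> {1..n}" "g k = u" using u(1) by (auto simp: bij_betw_def)
    have "adj v (g i) \<longleftrightarrow> i = k" if "1 \<le> i" "i \<le> n" for i
    proof -
      have "g i \<in> W" "g i = g k \<longleftrightarrow> i = k"
        using bij that k by (auto simp: bij_betw_def dest: inj_onD)
      then show ?thesis using u(2) k by simp
    qed
    then have "attached_vertex V adj D n k g W v"
      using that W v k by unfold_locales auto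
    then show ?thesis using k by blast
  qed
  obtain g n where "1 \<le> n \<and> induced_copy (dynkin_A n) g W \<or> 4 \<le> n \<and> induced_copy (dynkin_D n) g W \<or>
     n \<in> {6, 7, 8} \<and> induced_copy (dynkin_E n) g W"
    using dyn unfolding dynkin_on_def by blast
  then consider (A) "1 \<le> n" "induced_copy (dynkin_A n) g W" | (D) "4 \<le> n" "induced_copy (dynkin_D n) g W"
    | (E) "n \<in> {6, 7, 8}" "induced_copy (dynkin_E n) g W" by blast
  then show ?thesis
  proof cases
    case A
    obtain k where k: "attached_vertex V adj (dynkin_A n) n k g W v" "g k = u"
      using attach[OF A(2)] by (auto simp: dynkin_A_def)
    interpret a: attached_vertex V adj "dynkin_A n" n k g W v by (rule k(1))
    show ?thesis
    proof (cases "2 * k \<le> Suc n")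
      case True then show ?thesis using a.extend_A by blast
    next
      case False
      let ?g = "g \<circ> (\<lambda>i. Suc n - i)"
      interpret b: attached_vertex V adj "dynkin_A n" n "Suc n - k" ?g W v
      proof
        show "induced_copy (dynkin_A n) ?g W" by (rule induced_copy_A_rev[OF A(2)])
        show "adj v (?g i) \<longleftrightarrow> i = Suc n - k" if "1 \<le> i" "i \<le> n" for i
          using a.adj_v[of "Suc n - i"] that a.k by auto
      qed (use a.k W v in \<open>auto simp: dynkin_A_def\<close>)
      show ?thesis using b.extend_A False by simp
    qed
  next
    case D
    obtain k where k: "attached_vertex V adj (dynkin_D n) n k g W v" "g k = u"
      using attach[OF D(2)] by (auto simp: dynkin_D_def)
    interpret a: attached_vertex V adj "dynkin_D n" n k g W v by (rule k(1))
    show ?thesis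
    proof (cases "k = n")
      case False then show ?thesis using a.extend_D D by blast
    next
      case True
      let ?g = "g \<circ> (\<lambda>i. if i = 1 then n else if i = n then 1 else i)"
      interpret b: attached_vertex V adj "dynkin_D n" n 1 ?g W v
      proof
        show "induced_copy (dynkin_D n) ?g W" by (rule induced_copy_D_swap[OF D(2,1)])
        show "adj v (?g i) \<longleftrightarrow> i = 1" if "1 \<le> i" "i \<le> n" for i
          using a.adj_v[of 1] a.adj_v[of n] a.adj_v[of i] that True D(1) by auto
      qed (use D W v in \<open>auto simp: dynkin_D_def\<close>)
      show ?thesis using b.extend_D D by simp
    qed
  next
    case E
    obtain k where k: "attached_vertex V adj (dynkin_E n) n k g W v" "g k = u"
      using attach[OF E(2)] by (auto simp: dynkin_E_def)
    interpret a: attached_vertex V adj "dynkin_E n" n k g W v by (rule k(1))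
    show ?thesis using a.extend_E E by blast
  qed
qed

section \<open>Growing a Dynkin diagram inside a connected graph\<close>

text \<open>The subgraph is grown one vertex at a time.  The value of the form at the all-ones vector of
  \<open>W\<close> is twice the difference between the numbers of vertices and of edges; it starts at \<open>2\<close>,
  and a new vertex with \<open>d\<close> neighbours in \<open>W\<close> adds \<open>2 - 2d\<close>.  As the value stays positive and never
  exceeds \<open>2\<close>, each new vertex has exactly one neighbour, so no cycle can arise and
  only the single-attachment case is left.\<close>
lemma dynkin_on_connected:
  assumes "V \<noteq> {}"
    and cut: "\<And>P. P \<subseteq> V \<Longrightarrow> P \<noteq> {} \<Longrightarrow> P \<noteq> V \<Longrightarrow> \<exists>u\<in>P. \<exists>w\<in>V - P. adj u w"
  shows "dynkin_on V"
proof -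
  define total where "total W = (\<Sum>u\<in>W. \<Sum>w\<in>W. cartan u w)" for W
  have "\<exists>W\<subseteq>V. card W = Suc m \<and> dynkin_on W \<and> total W \<le> 2" if "Suc m \<le> card V" for m
    using that
  proof (induction m)
    case 0
    obtain v where v: "v \<in> V" using assms(1) by blast
    have "induced_copy (dynkin_A 1) (\<lambda>_. v) {v}"
      by (auto simp: induced_copy_def dynkin_A_def path_edges_def bij_betw_def adj_irrefl)
    then have "dynkin_on {v}" unfolding dynkin_on_def by (metis order_refl)
    then show ?case
      using v by (intro exI[of _ "{v}"]) (simp add: total_def cartan_def)
  next
    case (Suc m)
    then obtain W where W: "W \<subseteq> V" "card W = Suc m" "dynkin_on W" "total W \<le> 2" by auto
    have fin: "finite W" using W(1) finite_V finite_subset by blast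
    have "W \<noteq> {}" "W \<noteq> V" using W(2) Suc.prems by auto
    then obtain u v where uv: "u \<in> W" "v \<in> V - W" "adj u v" using cut[OF W(1)] by blast
    define N where "N = {w \<in> W. adj v w}"
    have row: "(\<Sum>w\<in>W. cartan v w) = - real (card N)"
    proof -
      have "(\<Sum>w\<in>W. cartan v w) = (\<Sum>w\<in>W. if adj v w then -1 else 0)"
        using uv by (intro sum.cong) (auto simp: cartan_def)
      also have "\<dots> = (\<Sum>w\<in>N. -1)"
        unfolding N_def by (rule sum.inter_filter[OF fin, symmetric])
      finally show ?thesis by simp
    qed
    have "(\<Sum>u\<in>W. cartan u v) = (\<Sum>w\<in>W. cartan v w)"
      using adj_sym by (intro sum.cong) (auto simp: cartan_def)
    then have total: "total (insert v W) = total W + 2 - 2 * real (card N)"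
      using fin uv row by (simp add: total_def sum.distrib cartan_def)
    have "0 < total (insert v W)"
      using cartan_positive[of "insert v W" "\<lambda>_. 1"] W(1) uv by (auto simp: total_def)
    with total W(4) have "card N < 2" by linarith
    moreover have uN: "u \<in> N" "finite N" using uv adj_sym fin by (auto simp: N_def)
    ultimately have "card N = 1" using card_gt_0_iff[of N] by fastforce
    then have "N = {u}" using uN by (auto simp: card_1_singleton_iff)
    then have "dynkin_on (insert v W)"
      using dynkin_on_insert[OF W(1) _ _ W(3) uv(1), of v] uv by (auto simp: N_def)
    moreover have "total (insert v W) \<le> 2" using total W(4) \<open>card N = 1\<close> by simp
    ultimately show ?case
      using W uv fin by (intro exI[of _ "insert v W"]) auto
  qed
  from this[of "card V - 1"] obtain W where "W \<subseteq> V" "card W = card V" "dynkin_on W"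
    using assms(1) finite_V by (auto simp: card_gt_0_iff Suc_leI)
  then show ?thesis using card_subset_eq[OF finite_V] by blast
qed

end

text \<open>Conjugation with the diagonal matrix of the signs \<open>s\<close> turns \<open>2I + A(K)\<close> into \<open>2I - A\<close>, where
  \<open>A\<close> is the adjacency matrix of the underlying unsigned graph.\<close>
lemma nonpositive_finite_type:
  fixes K :: "'a sgraph" and s :: "'a \<Rightarrow> int"
  assumes K: "signed_graph K" "positive_graph K"
    and s: "\<And>u. u \<in> verts K \<Longrightarrow> s u = 1 \<or> s u = -1"
    and neg: "\<And>u w. u \<in> verts K \<Longrightarrow> w \<in> verts K \<Longrightarrow> u \<noteq> w \<Longrightarrow> s u * s w * gram K u w \<le> 0"
  shows "finite_type_graph (verts K) (adjacent K)"
proof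
  show "finite (verts K)" using K by (simp add: signed_graph_def simple_graph_def)
  show "adjacent K w u" if "adjacent K u w" for u w using that by (simp add: insert_commute)
  show "\<not> adjacent K u u" for u using signed_graph_adjacentD(1)[OF K(1)] by blast
  let ?C = "\<lambda>u w. if u = w then 2 else if adjacent K u w then -1 else (0::real)"
  have C: "?C u w = real_of_int (s u * gram K u w * s w)" if "u \<in> verts K" "w \<in> verts K" for u w
  proof (cases "u = w")
    case True
    then show ?thesis using s[OF that(1)] gram_self[OF K(1)] by auto
  next
    case False
    then show ?thesis
      using s[OF that(1)] s[OF that(2)] neg[OF that False] gram_range[OF K(1) False]
        adjacent_iff_gram[OF K(1) False] by auto
  qed
  show "positive_definite_on (verts K) ?C"
    unfolding positive_definite_on_def
  proof (intro allI impI)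
    fix x :: "'a \<Rightarrow> real" assume "\<exists>v\<in>verts K. x v \<noteq> 0"
    moreover have "s v \<noteq> 0" if "v \<in> verts K" for v using s[OF that] by auto
    ultimately have "\<exists>v\<in>verts K. real_of_int (s v) * x v \<noteq> 0" by auto
    then have "0 < (\<Sum>v\<in>verts K. \<Sum>w\<in>verts K.
        (real_of_int (s v) * x v) * real_of_int (gram K v w) * (real_of_int (s w) * x w))"
      using K(2) unfolding positive_graph_gram positive_definite_on_def
      by (auto dest: spec[of _ "\<lambda>v. real_of_int (s v) * x v"])
    also have "\<dots> = (\<Sum>v\<in>verts K. \<Sum>w\<in>verts K. x v * ?C v w * x w)"
      by (intro sum.cong refl) (simp only: C of_int_mult mult_ac)
    finally show "0 < (\<Sum>v\<in>verts K. \<Sum>w\<in>verts K. x v * ?C v w * x w)" .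
  qed
qed

lemma graph_isomorphism_inv:
  assumes "graph_isomorphism f G H"
  shows "graph_isomorphism (the_inv_into (verts G) f) H G"
proof -
  have f: "bij_betw f (verts G) (verts H)" using assms by (simp add: graph_isomorphism_def)
  have "the_inv_into (verts G) f v \<in> verts G" "f (the_inv_into (verts G) f v) = v"
    if "v \<in> verts H" for v
    using f that by (auto simp: bij_betw_def the_inv_into_into f_the_inv_into_f)
  then show ?thesis
    using assms bij_betw_the_inv_into[OF f] by (simp add: graph_isomorphism_def)
qed

theorem theorem1p2:
  fixes G :: "'a sgraph"
  assumes "signed_graph G"
    and "verts G \<noteq> {}"
    and "connected_graph G"
    and "positive_graph G"
  shows "\<exists>H :: 'a sgraph. signed_graph H \<and> t_equivalent G H \<and> simply_laced_dynkin H"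
proof -
  obtain K s where K: "t_move\<^sup>*\<^sup>* G K" and s: "\<And>u. u \<in> verts G \<Longrightarrow> s u = 1 \<or> s u = (-1::int)"
    "\<And>u w. u \<in> verts G \<Longrightarrow> w \<in> verts G \<Longrightarrow> u \<noteq> w \<Longrightarrow> s u * s w * gram K u w \<le> 0"
    using t_equivalent_nonpositive[OF assms(1,4)] by blast
  have inv: "signed_graph K" "positive_graph K" "verts K = verts G" "cut_connected K"
    using t_move_invariants[OF K assms(1,4)] connected_graph_cut_connected assms(1,3)
    by (auto simp: signed_graph_def)
  interpret finite_type_graph "verts K" "adjacent K"
    using nonpositive_finite_type[of K s] inv s by simp
  have "dynkin_on (verts K)"
    using dynkin_on_connected assms(2) inv(3,4) by (auto simp: cut_connected_def)
  moreover have "graph_iso K D" if "induced_copy D g (verts K)" for D g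
  proof -
    have "graph_isomorphism g D K" using that by (auto simp: induced_copy_def graph_isomorphism_def)
    then show ?thesis using graph_isomorphism_inv unfolding graph_iso_def by blast
  qed
  ultimately have "simply_laced_dynkin K"
    unfolding dynkin_on_def simply_laced_dynkin_def by blast
  moreover have "signed_iso K K"
    unfolding signed_iso_def graph_isomorphism_def by (intro exI[of _ id]) auto
  then have "t_equivalent G K" using K by (auto simp: t_equivalent_def)
  ultimately show ?thesis using inv(1) by blast
qed

end
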